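(* Let $n\ge 2$, let $\Omega\subset\mathbb{R}^n$ be a smooth bounded domain, $u\in C^\infty(\overline\Omega)$, $\varphi\in C^1(\overline\Omega)$, $\alpha\in[0,n-1)$ and $y\in\mathbb{R}^n$. Assume that either $u=0$ on $\partial\Omega$ or $\varphi=0$ on $\partial\Omega$. Then $$(n-1-\alpha)\int_\Omega|\nabla u|\varphi^2r_y^{-\alpha}\,dx+\alpha\int_\Omega\frac{u_{r_y}^2}{|\nabla u|}\varphi^2r_y^{-\alpha}\,dx$$ $$\le\left(\int_\Omega|\nabla u|\varphi^2r_y^{-\alpha}\,dx\right)^{1/2}\left(\int_{\Omega\cap\{|\nabla u|>0\}}|\nabla u|\left(4|\nabla_T\varphi|^2+H^2\varphi^2\right)r_y^{2-\alpha}\,dx\right)^{1/2}.$$ In particular, $$(n-1-\alpha)^2\int_\Omega|\nabla u|\varphi^2r_y^{-\alpha}\,dx\le\int_{\Omega\cap\{|\nabla u|>0\}}|\nabla u|\left(4|\nabla_T\varphi|^2+H^2\varphi^2\right)r_y^{2-\alpha}\,dx.$$ Moreover, if $u$ is radially symmetric about $y$ (i.e. $u(x)$ depends only on $|x-y|$), then $$(n-1)^2\int_\Omega|u_{r_y}|\varphi^2r_y^{-\alpha}\,dx\le\int_{\Omega\cap\{|\nabla u|>0\}}|u_{r_y}|\left(4|\nabla_T\varphi|^2+H^2\varphi^2\right)r_y^{2-\alpha}\,dx.$$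
   Context: Notation: $r_y(x)=|x-y|$ and $u_{r_y}(x)=\nabla u(x)\cdot\frac{x-y}{|x-y|}$. The integrand $u_{r_y}^2/|\nabla u|$ is interpreted as $0$ where $\nabla u=0$. On the set $\{x\in\Omega:|\nabla u(x)|>0\}$ let $\nu=\nabla u/|\nabla u|$ (unit normal to the level sets of $u$), let $\nabla_T\varphi:=\nabla\varphi-\langle\nabla\varphi,\nu\rangle\nu$ be the tangential gradient along the level sets of $u$, and let $H:=\operatorname{div}\nu=\sum_{i=1}^n\partial_i\nu^i$ be the mean curvature of the level sets of $u$ (the sum of their principal curvatures). *)

theory Defs
  imports "HOL-Analysis.Analysis"
begin

definition grad :: "('a::euclidean_space \<Rightarrow> real) \<Rightarrow> 'a \<Rightarrow> 'a" where
  "grad f x = (\<Sum>b\<in>Basis. frechet_derivative f (at x) b *\<^sub>R b)"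

definition divergence :: "('a::euclidean_space \<Rightarrow> 'a) \<Rightarrow> 'a \<Rightarrow> real" where
  "divergence F x = (\<Sum>b\<in>Basis. frechet_derivative F (at x) b \<bullet> b)"

fun iter_partial :: "'a::euclidean_space list \<Rightarrow> ('a \<Rightarrow> real) \<Rightarrow> 'a \<Rightarrow> real" where
  "iter_partial [] f = f"
| "iter_partial (v # vs) f = (\<lambda>x. frechet_derivative (iter_partial vs f) (at x) v)"

definition smooth_on :: "'a::euclidean_space set \<Rightarrow> ('a \<Rightarrow> real) \<Rightarrow> bool" where
  "smooth_on U f \<longleftrightarrow> (\<forall>vs. set vs \<subseteq> Basis \<longrightarrow> iter_partial vs f differentiable_on U)"

definition C1_on :: "'a::euclidean_space set \<Rightarrow> ('a \<Rightarrow> real) \<Rightarrow> bool" where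
  "C1_on U f \<longleftrightarrow> f differentiable_on U \<and> continuous_on U (grad f)"

text \<open>Smooth bounded domain: bounded, open, connected, with C-infinity boundary given by a
  global defining function rho (Omega = {rho < 0}, grad rho nonzero on {rho = 0}).\<close>
definition smooth_bounded_domain :: "'a::euclidean_space set \<Rightarrow> bool" where
  "smooth_bounded_domain \<Omega> \<longleftrightarrow> open \<Omega> \<and> connected \<Omega> \<and> bounded \<Omega> \<and> \<Omega> \<noteq> {} \<and>
     (\<exists>\<rho>. smooth_on UNIV \<rho> \<and> \<Omega> = {x. \<rho> x < 0} \<and> (\<forall>x. \<rho> x = 0 \<longrightarrow> grad \<rho> x \<noteq> 0))"

definition smooth_on_closure :: "'a::euclidean_space set \<Rightarrow> ('a \<Rightarrow> real) \<Rightarrow> bool" where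
  "smooth_on_closure \<Omega> f \<longleftrightarrow> (\<exists>U. open U \<and> closure \<Omega> \<subseteq> U \<and> smooth_on U f)"

definition C1_on_closure :: "'a::euclidean_space set \<Rightarrow> ('a \<Rightarrow> real) \<Rightarrow> bool" where
  "C1_on_closure \<Omega> f \<longleftrightarrow> (\<exists>U. open U \<and> closure \<Omega> \<subseteq> U \<and> C1_on U f)"

text \<open>Radial derivative u_{r_y}(x) = grad u(x) . (x-y)/|x-y| (equal to 0 at x = y).\<close>
definition rad_deriv :: "('a::euclidean_space \<Rightarrow> real) \<Rightarrow> 'a \<Rightarrow> 'a \<Rightarrow> real" where
  "rad_deriv u y x = grad u x \<bullet> ((1 / norm (x - y)) *\<^sub>R (x - y))"

text \<open>Unit normal nu = grad u / |grad u| (meaningful where grad u is nonzero).\<close>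
definition unit_normal :: "('a::euclidean_space \<Rightarrow> real) \<Rightarrow> 'a \<Rightarrow> 'a" where
  "unit_normal u x = (1 / norm (grad u x)) *\<^sub>R grad u x"

definition tan_grad :: "('a::euclidean_space \<Rightarrow> real) \<Rightarrow> ('a \<Rightarrow> real) \<Rightarrow> 'a \<Rightarrow> 'a" where
  "tan_grad u \<phi> x = grad \<phi> x - (grad \<phi> x \<bullet> unit_normal u x) *\<^sub>R unit_normal u x"

definition mean_curv :: "('a::euclidean_space \<Rightarrow> real) \<Rightarrow> 'a \<Rightarrow> real" where
  "mean_curv u x = divergence (unit_normal u) x"

definition ennsqrt :: "ennreal \<Rightarrow> ennreal" where
  "ennsqrt x = (if x = \<infinity> then \<infinity> else ennreal (sqrt (enn2real x)))"

end

theory Submission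
  imports Defs
begin

text \<open>
  For a vector field \<open>X\<close>, the divergence of \<open>|\<nabla>u| X - (X \<bullet> \<nabla>u) \<nu>\<close>, the field \<open>|\<nabla>u|\<close> times the part of \<open>X\<close>
  tangential to the level sets, equals \<open>|\<nabla>u|\<close> times the tangential divergence of \<open>X\<close> minus
  \<open>|\<nabla>u| H (X \<bullet> \<nu>)\<close>. The field has no flux through the boundary of \<open>\<Omega>\<close>, either because it is tangential
  to \<open>{u = 0}\<close> or because \<open>X\<close> vanishes. Taking \<open>X = \<phi>\<^sup>2 (r\<^sup>2 + \<delta>) powr (- \<alpha> / 2) (x - y)\<close>, splitting \<open>x - y\<close> into
  normal and tangential parts, and applying Cauchy-Schwarz first pointwise and then to the integrals
  gives the inequality for the regularized weight; monotone convergence removes \<open>\<delta>\<close>.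

  Neither the coarea formula nor a boundary integral is needed: \<open>|\<nabla>u|\<close> is regularized as
  \<open>sqrt (|\<nabla>u|\<^sup>2 + \<epsilon>\<^sup>2)\<close>, and \<open>X\<close> is cut off near the boundary by a function of \<open>u\<close> (respectively of \<open>\<phi>\<close>).
  The former cutoff also removes \<open>{u = 0}\<close>, but \<open>\<nabla>u = 0\<close> almost everywhere on that set.
\<close>

text \<open>Constants: the tangential divergence of \<open>x - y\<close> is \<open>n - 1\<close>,
  the derivative of the weight costs \<alpha> times the squared tangential part of
  \<open>x - y\<close> over the squared distance, and 4 is the square of the 2 in the gradient of
  \<open>\<phi>^2\<close>, namely \<open>2 \<phi>\<close> times that of \<phi>. Two singularities
  shape the proof. At critical points \<nu> and H are uncontrolled, but |grad u| H is bounded, so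
  the divergences of the regularized fields are bounded uniformly and dominated convergence applies.
  Near the boundary a steep cutoff would have an unbounded gradient; a function of u has gradient
  along \<nu>, which a tangential field does not see, and for \<phi> the square of the test function
  is itself truncated, so that its derivative stays dominated. The shift \<delta> keeps the test
  function C1 across y and makes the first integral finite, which is what allows its square root to
  be cancelled; the right-hand integral may be infinite throughout. For radial u, |u_r| = |grad u|
  off y, so both integrals on the left coincide and the coefficients add up to
  \<open>n - 1\<close>.\<close>

subsection \<open>Integration of compactly supported divergences\<close>

lemma has_derivative_along_line:
  fixes f :: "'a::real_normed_vector \<Rightarrow> real"
  assumes "(f has_derivative D) (at (x + t *\<^sub>R b))"
  shows "((\<lambda>t. f (x + t *\<^sub>R b)) has_field_derivative D b) (at t)"
proof -
  have "((\<lambda>t. f (x + t *\<^sub>R b)) has_derivative (\<lambda>s. D (s *\<^sub>R b))) (at t)"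
    by (rule has_derivative_compose[where f="\<lambda>t. x + t *\<^sub>R b", OF _ assms]) (auto intro!: derivative_eq_intros)
  moreover have "D (s *\<^sub>R b) = D b * s" for s
    using linear_cmul[OF has_derivative_linear[OF assms]] by simp
  ultimately show ?thesis
    by (simp add: has_field_derivative_def)
qed

text \<open>Difference quotients of an integrable function integrate to 0 because Lebesgue measure
  is translation invariant. They converge to \<open>D x b\<close> and, by the mean value theorem,
  stay below C on a fixed ball, so dominated convergence carries the 0 to the limit.\<close>

lemma integral_directional_derivative_eq_0:
  fixes f :: "'a::euclidean_space \<Rightarrow> real"
  assumes df: "\<And>x. (f has_derivative D x) (at x)"
    and bound: "\<And>x. \<bar>D x b\<bar> \<le> C"
    and zero: "\<And>x. x \<notin> S \<Longrightarrow> f x = 0" and S: "bounded S"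
  shows "integrable lborel (\<lambda>x. D x b)" "integral\<^sup>L lborel (\<lambda>x. D x b) = 0"
proof -
  define h where "h n = 1 / real (Suc n)" for n
  have h: "h n > 0" "h n \<le> 1" for n by (auto simp: h_def)
  have h0: "h \<longlonglongrightarrow> 0" unfolding h_def by (rule LIMSEQ_Suc[OF lim_1_over_n])
  define s where "s n x = (f (x + h n *\<^sub>R b) - f x) / h n" for n x
  obtain R where R: "\<And>x. x \<in> S \<Longrightarrow> norm x \<le> R" using S by (auto simp: bounded_iff)
  define w where "w x = C * indicator (cball 0 (R + norm b)) x" for x :: 'a
  have cf: "continuous_on UNIV f"
    by (intro continuous_at_imp_continuous_on ballI has_derivative_continuous[OF df])
  have mf[measurable]: "f \<in> borel_measurable borel"
    using cf by (rule borel_measurable_continuous_onI)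
  have ms[measurable]: "s n \<in> borel_measurable lborel" for n
    unfolding s_def by measurable
  have lim: "(\<lambda>n. s n x) \<longlonglongrightarrow> D x b" for x
  proof -
    have "((\<lambda>t. f (x + t *\<^sub>R b)) has_field_derivative D x b) (at 0)"
      by (rule has_derivative_along_line) (simp add: df)
    then have "((\<lambda>t. (f (x + t *\<^sub>R b) - f x) / t) \<longlongrightarrow> D x b) (at 0)"
      by (simp add: has_field_derivative_iff)
    moreover have "filterlim h (at 0) sequentially"
      using h0 h(1) by (auto simp: filterlim_at intro!: always_eventually) (metis less_irrefl)
    ultimately show ?thesis
      unfolding s_def by (rule filterlim_compose)
  qed
  have mD[measurable]: "(\<lambda>x. D x b) \<in> borel_measurable lborel"
    by (rule borel_measurable_LIMSEQ_real[OF lim ms])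
  have bd: "norm (s n x) \<le> w x" for n x
  proof (cases "norm x \<le> R + norm b")
    case True
    obtain \<xi> where "f (x + h n *\<^sub>R b) - f (x + 0 *\<^sub>R b) = (h n - 0) * D (x + \<xi> *\<^sub>R b) b"
      using MVT2[OF h(1), where f="\<lambda>t. f (x + t *\<^sub>R b)" and f'="\<lambda>t. D (x + t *\<^sub>R b) b"]
        has_derivative_along_line[OF df] by metis
    then have "s n x = D (x + \<xi> *\<^sub>R b) b"
      unfolding s_def using h(1)[of n] by simp
    then show ?thesis using bound True by (simp add: w_def)
  next
    case False
    have "norm (h n *\<^sub>R b) \<le> norm b"
      using h[of n] by (simp add: mult_left_le_one_le)
    then have "norm x \<le> norm (x + h n *\<^sub>R b) + norm b"
      by (metis add_diff_cancel_right' norm_triangle_ineq4 add_left_mono order_trans)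
    with False have "x \<notin> S" "x + h n *\<^sub>R b \<notin> S"
      using R[of x] R[of "x + h n *\<^sub>R b"] by (auto) (smt (verit) norm_ge_zero)
    then show ?thesis using False by (simp add: s_def w_def zero)
  qed
  have iw: "integrable lborel w"
    unfolding w_def by (intro integrable_mult_right integrable_real_indicator) (use emeasure_bounded_finite[OF bounded_cball] in \<open>auto simp: less_top\<close>)
  show "integrable lborel (\<lambda>x. D x b)"
    by (rule integrable_dominated_convergence[where s=s, OF mD ms iw]) (use lim bd in auto)
  have L: "(\<lambda>n. integral\<^sup>L lborel (s n)) \<longlonglongrightarrow> integral\<^sup>L lborel (\<lambda>x. D x b)"
    by (rule integral_dominated_convergence[where s=s, OF mD ms iw]) (use lim bd in auto)
  have "compact (cball (0::'a) R)" by simp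
  then have "bounded (f ` cball 0 R)"
    by (intro compact_imp_bounded compact_continuous_image continuous_on_subset[OF cf]) auto
  then obtain M where M: "\<And>x. x \<in> cball 0 R \<Longrightarrow> norm (f x) \<le> M" unfolding bounded_iff by blast
  have if': "integrable lborel f"
  proof (rule Bochner_Integration.integrable_bound)
    show "integrable lborel (\<lambda>x::'a. M * indicator (cball 0 R) x)"
      by (intro integrable_mult_right integrable_real_indicator) (use emeasure_bounded_finite[OF bounded_cball] in \<open>auto simp: less_top\<close>)
    show "AE x in lborel. norm (f x) \<le> norm (M * indicator (cball 0 R) x)"
    proof (rule AE_I2)
      fix x
      show "norm (f x) \<le> norm (M * indicator (cball 0 R) x)"
      proof (cases "x \<in> cball 0 R")
        case True
        then show ?thesis using M[of x] by simp
      next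
        case False
        then have "x \<notin> S" using R by auto
        then show ?thesis by (simp add: zero)
      qed
    qed
  qed simp
  have I0: "integral\<^sup>L lborel (s n) = 0" for n
  proof -
    have "integral\<^sup>L lborel f = integral\<^sup>L (distr lborel borel ((+) (h n *\<^sub>R b))) f"
      by (simp add: lborel_distr_plus)
    also have "\<dots> = (\<integral>x. f (x + h n *\<^sub>R b) \<partial>lborel)"
      by (subst integral_distr) (auto simp: add.commute)
    finally have e: "integral\<^sup>L lborel f = (\<integral>x. f (x + h n *\<^sub>R b) \<partial>lborel)" .
    have "integrable (distr lborel borel ((+) (h n *\<^sub>R b))) f"
      using if' by (simp add: lborel_distr_plus)
    then have "integrable lborel (\<lambda>x. f (x + h n *\<^sub>R b))"
      by (subst (asm) integrable_distr_eq) (auto simp: add.commute)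
    with if' e show ?thesis unfolding s_def by simp
  qed
  show "integral\<^sup>L lborel (\<lambda>x. D x b) = 0"
    using L unfolding I0 by (simp add: LIMSEQ_const_iff)
qed

section \<open>Traces of derivatives and the divergence theorem\<close>

definition lin_trace :: "('a::euclidean_space \<Rightarrow> 'a) \<Rightarrow> real" where
  "lin_trace L = (\<Sum>b\<in>Basis. L b \<bullet> b)"

lemma lin_trace_add: "lin_trace (\<lambda>v. F v + G v) = lin_trace F + lin_trace G"
  by (simp add: lin_trace_def inner_add_left sum.distrib)

lemma lin_trace_diff: "lin_trace (\<lambda>v. F v - G v) = lin_trace F - lin_trace G"
  by (simp add: lin_trace_def inner_diff_left sum_subtractf)

lemma lin_trace_scaleR: "lin_trace (\<lambda>v. c *\<^sub>R F v) = c * lin_trace F"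
  by (simp add: lin_trace_def sum_distrib_left)

lemma lin_trace_ident: "lin_trace (\<lambda>v::'a::euclidean_space. v) = DIM('a)"
  by (simp add: lin_trace_def)

text \<open>This is how the derivative l of a scalar coefficient of a vector w enters a
  divergence.\<close>

lemma lin_trace_rank_one:
  fixes w :: "'a::euclidean_space"
  assumes "linear l"
  shows "lin_trace (\<lambda>v. l v *\<^sub>R w) = l w"
proof -
  have "l w = l (\<Sum>b\<in>Basis. (w \<bullet> b) *\<^sub>R b)" by (simp add: euclidean_representation)
  also have "\<dots> = (\<Sum>b\<in>Basis. (w \<bullet> b) * l b)"
    using assms by (simp add: linear_sum linear_cmul)
  finally show ?thesis by (simp add: lin_trace_def mult.commute)
qed

lemma divergence_eq_lin_trace:
  assumes "(F has_derivative D) (at x)"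
  shows "divergence F x = lin_trace D"
  unfolding divergence_def lin_trace_def
  using frechet_derivative_at[OF assms] by simp

theorem integral_divergence_eq_0:
  fixes F :: "'a::euclidean_space \<Rightarrow> 'a"
  assumes "open \<Omega>" "bounded \<Omega>" "compact K" "K \<subseteq> \<Omega>"
    and dF: "\<And>x. x \<in> \<Omega> \<Longrightarrow> (F has_derivative D x) (at x)"
    and bound: "\<And>b. b \<in> Basis \<Longrightarrow> bounded ((\<lambda>x. D x b \<bullet> b) ` \<Omega>)"
    and zero: "\<And>x. x \<in> \<Omega> \<Longrightarrow> x \<notin> K \<Longrightarrow> F x = 0"
  shows "integrable lborel (\<lambda>x. indicator \<Omega> x * lin_trace (D x))"
    "(\<integral>x. indicator \<Omega> x * lin_trace (D x) \<partial>lborel) = 0"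
proof -
  define G where "G x = (if x \<in> \<Omega> then F x else 0)" for x
  define E where "E x = (if x \<in> \<Omega> then D x else (\<lambda>_. 0))" for x
  have dG: "(G has_derivative E x) (at x)" for x
  proof (cases "x \<in> \<Omega>")
    case True
    show ?thesis
      using dF[OF True] True \<open>open \<Omega>\<close>
      by (auto simp: E_def G_def intro: has_derivative_transform_within_open[where s=\<Omega>])
  next
    case False
    \<comment> \<open>Outside \<Omega> the extension by 0 is differentiable because the complement
      of K is a neighbourhood on which it vanishes identically.\<close>
    have "open (- K)" using \<open>compact K\<close> compact_imp_closed by blast
    with False \<open>K \<subseteq> \<Omega>\<close> zero show ?thesis
      by (auto simp: E_def G_def
          intro!: has_derivative_transform_within_open[of "\<lambda>_. 0" "\<lambda>_. 0" x UNIV "- K" G])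
  qed
  have bE: "\<exists>C. \<forall>x. \<bar>E x b \<bullet> b\<bar> \<le> C" if b: "b \<in> Basis" for b
  proof -
    obtain C where C: "\<And>x. x \<in> \<Omega> \<Longrightarrow> \<bar>D x b \<bullet> b\<bar> \<le> C"
      using bound[OF b] by (auto simp: bounded_iff)
    have "\<bar>E x b \<bullet> b\<bar> \<le> \<bar>C\<bar>" for x
      using C[of x] by (auto simp: E_def)
    then show ?thesis by blast
  qed
  have 1: "((\<lambda>x. G x \<bullet> b) has_derivative (\<lambda>v. E x v \<bullet> b)) (at x)" for x b
    using dG by (auto intro!: derivative_eq_intros)
  have I: "integrable lborel (\<lambda>x. E x b \<bullet> b)" "integral\<^sup>L lborel (\<lambda>x. E x b \<bullet> b) = 0"
    if "b \<in> Basis" for b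
  proof -
    obtain C where C: "\<And>x. \<bar>E x b \<bullet> b\<bar> \<le> C" using bE \<open>b \<in> Basis\<close> by blast
    note * = integral_directional_derivative_eq_0[where S=\<Omega>, OF 1 C _ \<open>bounded \<Omega>\<close>]
    show "integrable lborel (\<lambda>x. E x b \<bullet> b)" "integral\<^sup>L lborel (\<lambda>x. E x b \<bullet> b) = 0"
      by (rule *; simp add: G_def)+
  qed
  have e: "indicator \<Omega> x * lin_trace (D x) = (\<Sum>b\<in>Basis. E x b \<bullet> b)" for x
    by (auto simp: E_def lin_trace_def)
  show "integrable lborel (\<lambda>x. indicator \<Omega> x * lin_trace (D x))"
    unfolding e using I(1) by (intro Bochner_Integration.integrable_sum)
  show "(\<integral>x. indicator \<Omega> x * lin_trace (D x) \<partial>lborel) = 0"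
    unfolding e using I by (subst Bochner_Integration.integral_sum) auto
qed

text \<open>Both mixed derivatives are realised, at points close to \<open>x\<close>, by the same second difference.\<close>

lemma mixed_difference_mean_value:
  fixes f :: "'a::real_normed_vector \<Rightarrow> real"
  assumes "t > 0"
    and f: "\<And>p. dist p x \<le> t * (norm v + norm w) \<Longrightarrow> (f has_derivative D p) (at p)"
    and D: "\<And>p. dist p x \<le> t * (norm v + norm w) \<Longrightarrow> ((\<lambda>p. D p v) has_derivative D2 p) (at p)"
  shows "\<exists>p. dist p x \<le> t * (norm v + norm w) \<and>
    f (x + t *\<^sub>R v + t *\<^sub>R w) - f (x + t *\<^sub>R v) - f (x + t *\<^sub>R w) + f x = t\<^sup>2 * D2 p w"
proof -
  have near: "dist (x + r *\<^sub>R v + s *\<^sub>R w) x \<le> t * (norm v + norm w)"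
    if "0 \<le> r" "r \<le> t" "0 \<le> s" "s \<le> t" for r s
  proof -
    have "norm (r *\<^sub>R v + s *\<^sub>R w) \<le> r * norm v + s * norm w"
      using that by (metis abs_of_nonneg norm_scaleR norm_triangle_ineq)
    also have "\<dots> \<le> t * norm v + t * norm w"
      using that by (intro add_mono mult_right_mono) auto
    finally show ?thesis by (simp add: dist_norm add.assoc distrib_left)
  qed
  \<comment> \<open>Mean value theorem in direction v for the increment of f across
    \<open>t *\<^sub>R w\<close>; below, once more in direction w for the increment of
    \<open>D _ v\<close>.\<close>
  have "\<exists>r>0. r < t \<and> (f (x + t *\<^sub>R w + t *\<^sub>R v) - f (x + t *\<^sub>R v)) - (f (x + t *\<^sub>R w + 0 *\<^sub>R v) - f (x + 0 *\<^sub>R v))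
     = (t - 0) * (D (x + t *\<^sub>R w + r *\<^sub>R v) v - D (x + r *\<^sub>R v) v)"
  proof (rule MVT2[OF \<open>t > 0\<close>])
    fix r assume r: "0 \<le> r" "r \<le> t"
    show "((\<lambda>r. f (x + t *\<^sub>R w + r *\<^sub>R v) - f (x + r *\<^sub>R v)) has_field_derivative
       D (x + t *\<^sub>R w + r *\<^sub>R v) v - D (x + r *\<^sub>R v) v) (at r)"
      using near[OF r, of t] near[OF r, of 0] \<open>t > 0\<close>
      by (intro DERIV_diff has_derivative_along_line f) (auto simp: algebra_simps)
  qed
  then obtain r where r: "r > 0" "r < t" and e1:
    "f (x + t *\<^sub>R v + t *\<^sub>R w) - f (x + t *\<^sub>R v) - f (x + t *\<^sub>R w) + f x
      = t * (D (x + r *\<^sub>R v + t *\<^sub>R w) v - D (x + r *\<^sub>R v) v)"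
    by (auto simp: algebra_simps)
  have "\<exists>s>0. s < t \<and> D (x + r *\<^sub>R v + t *\<^sub>R w) v - D (x + r *\<^sub>R v + 0 *\<^sub>R w) v
     = (t - 0) * D2 (x + r *\<^sub>R v + s *\<^sub>R w) w"
    by (rule MVT2[OF \<open>t > 0\<close>, where f="\<lambda>s. D (x + r *\<^sub>R v + s *\<^sub>R w) v"], rule has_derivative_along_line, rule D)
      (use near r in auto)
  then obtain s where "s > 0" "s < t"
     "D (x + r *\<^sub>R v + t *\<^sub>R w) v - D (x + r *\<^sub>R v) v = t * D2 (x + r *\<^sub>R v + s *\<^sub>R w) w"
    by auto
  with e1 near[of r s] r show ?thesis
    by (intro exI[of _ "x + r *\<^sub>R v + s *\<^sub>R w"]) (auto simp: power2_eq_square)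
qed

text \<open>The second difference is symmetric in v and w, so \<open>Dv (p n) w = Dw (q n) v\<close>
  at points tending to x, and continuity at x concludes. Applied to u, it yields the symmetric
  Hessian on which a cancellation in the divergence of the flux rests.\<close>

lemma mixed_derivatives_commute:
  fixes f :: "'a::real_normed_vector \<Rightarrow> real"
  assumes "open U" "x \<in> U"
    and f: "\<And>p. p \<in> U \<Longrightarrow> (f has_derivative D p) (at p)"
    and Dv: "\<And>p. p \<in> U \<Longrightarrow> ((\<lambda>p. D p v) has_derivative Dv p) (at p)"
    and Dw: "\<And>p. p \<in> U \<Longrightarrow> ((\<lambda>p. D p w) has_derivative Dw p) (at p)"
    and cont: "isCont (\<lambda>p. Dv p w) x" "isCont (\<lambda>p. Dw p v) x"
  shows "Dv x w = Dw x v"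
proof -
  obtain e where e: "e > 0" "cball x e \<subseteq> U" using assms(1,2) open_contains_cball by blast
  \<comment> \<open>The summand 1 keeps m positive when v and w are both 0, so that
    \<open>t n\<close> is well defined.\<close>
  define m where "m = norm v + norm w + 1"
  have m: "m > 0" unfolding m_def by (smt (verit) norm_ge_zero)
  define t where "t n = e / (m * real (Suc n))" for n
  have t: "t n > 0" for n using e m by (simp add: t_def)
  have te: "t n * (norm v + norm w) \<le> e / Suc n" for n
  proof -
    have "t n * (norm v + norm w) \<le> t n * m" using t[of n] by (simp add: m_def)
    also have "\<dots> = e / Suc n" using m by (simp add: t_def)
    finally show ?thesis .
  qed
  also have "e / Suc n \<le> e" for n using e by (simp add: field_simps)
  finally have te': "t n * (norm v + norm w) \<le> e" for n .
  have inU: "p \<in> U" if "dist p x \<le> t n * (norm v + norm w)" for p n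
    using that te'[of n] e(2) by (auto simp: dist_commute subset_iff)
  have inU': "p \<in> U" if "dist p x \<le> t n * (norm w + norm v)" for p n
    using inU[of p n] that by (simp add: add.commute)
  have "\<exists>p. dist p x \<le> t n * (norm v + norm w) \<and>
    f (x + t n *\<^sub>R v + t n *\<^sub>R w) - f (x + t n *\<^sub>R v) - f (x + t n *\<^sub>R w) + f x = (t n)\<^sup>2 * Dv p w" for n
    by (rule mixed_difference_mean_value[OF t f Dv]) (auto dest: inU)
  then obtain p where p: "\<And>n. dist (p n) x \<le> t n * (norm v + norm w)"
    "\<And>n. f (x + t n *\<^sub>R v + t n *\<^sub>R w) - f (x + t n *\<^sub>R v) - f (x + t n *\<^sub>R w) + f x = (t n)\<^sup>2 * Dv (p n) w"
    by metis
  have "\<exists>p. dist p x \<le> t n * (norm w + norm v) \<and>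
    f (x + t n *\<^sub>R w + t n *\<^sub>R v) - f (x + t n *\<^sub>R w) - f (x + t n *\<^sub>R v) + f x = (t n)\<^sup>2 * Dw p v" for n
    by (rule mixed_difference_mean_value[OF t f Dw]) (auto dest: inU')
  then obtain q where q: "\<And>n. dist (q n) x \<le> t n * (norm w + norm v)"
    "\<And>n. f (x + t n *\<^sub>R w + t n *\<^sub>R v) - f (x + t n *\<^sub>R w) - f (x + t n *\<^sub>R v) + f x = (t n)\<^sup>2 * Dw (q n) v"
    by metis
  have eq: "Dv (p n) w = Dw (q n) v" for n
  proof -
    have "(t n)\<^sup>2 * Dv (p n) w = (t n)\<^sup>2 * Dw (q n) v"
      unfolding p(2)[symmetric] q(2)[symmetric] by (simp add: algebra_simps)
    then show ?thesis using t[of n] by simp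
  qed
  have lim0: "(\<lambda>n. e / real (Suc n)) \<longlonglongrightarrow> 0"
    using LIMSEQ_Suc[OF lim_const_over_n] .
  have close: "z \<longlonglongrightarrow> x" if "\<And>n. dist (z n) x \<le> t n * (norm v + norm w)" for z
  proof (rule metric_tendsto_imp_tendsto[OF lim0])
    have "dist (z n) x \<le> dist (e / real (Suc n)) 0" for n
      using order_trans[OF that[of n] te[of n]] \<open>e > 0\<close> by simp
    then show "\<forall>\<^sub>F n in sequentially. dist (z n) x \<le> dist (e / real (Suc n)) 0" by simp
  qed
  have "p \<longlonglongrightarrow> x" by (rule close) (rule p(1))
  then have 1: "(\<lambda>n. Dv (p n) w) \<longlonglongrightarrow> Dv x w"
    by (rule isCont_tendsto_compose[OF cont(1)])
  have "q \<longlonglongrightarrow> x" by (rule close) (use q(1) in \<open>simp add: add.commute\<close>)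
  then have "(\<lambda>n. Dw (q n) v) \<longlonglongrightarrow> Dw x v"
    by (rule isCont_tendsto_compose[OF cont(2)])
  with 1 show ?thesis unfolding eq using LIMSEQ_unique by blast
qed

subsection \<open>The tangential part of a radial field\<close>

lemma bounded_inner_comp:
  fixes f g :: "'b \<Rightarrow> 'a::real_inner"
  assumes "bounded (f ` S)" "bounded (g ` S)"
  shows "bounded ((\<lambda>x. f x \<bullet> g x) ` S)"
proof -
  obtain B C where B: "\<And>x. x \<in> S \<Longrightarrow> norm (f x) \<le> B" and C: "\<And>x. x \<in> S \<Longrightarrow> norm (g x) \<le> C"
    using assms by (auto simp: bounded_iff)
  have "norm (f x \<bullet> g x) \<le> B * C" if "x \<in> S" for x
    using Cauchy_Schwarz_ineq2[of "f x" "g x"] mult_mono[OF B[OF that] C[OF that]]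
      order_trans[OF norm_ge_zero B[OF that]] by auto
  then show ?thesis unfolding bounded_iff by blast
qed

lemma bounded_mult_comp:
  fixes f g :: "'b \<Rightarrow> real"
  assumes "bounded (f ` S)" "bounded (g ` S)"
  shows "bounded ((\<lambda>x. f x * g x) ` S)"
  using bounded_inner_comp[OF assms] by simp

lemma bounded_scaleR_comp2:
  fixes f :: "'b \<Rightarrow> real" and g :: "'b \<Rightarrow> 'a::real_normed_vector"
  assumes "bounded (f ` S)" "bounded (g ` S)"
  shows "bounded ((\<lambda>x. f x *\<^sub>R g x) ` S)"
  using bounded_mult_comp[of "\<lambda>x. norm (f x)" S "\<lambda>x. norm (g x)"] assms
  by (simp add: bounded_iff)

lemma bounded_const_comp: "bounded ((\<lambda>x. c) ` S)"
  by (rule finite_imp_bounded) (auto intro: finite_subset[of _ "{c}"])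

text \<open>A sequence of functions on S is treated as one function on
  \<open>UNIV \<times> S\<close>: boundedness of its image is a bound uniform in n, as dominated
  convergence requires.\<close>

lemma bounded_snd_comp: "bounded (f ` S) \<Longrightarrow> bounded ((\<lambda>q. f (snd q)) ` (T \<times> S))"
  by (erule bounded_subset) auto

lemma bounded_fst_slice:
  assumes "bounded ((\<lambda>q. f (fst q) (snd q)) ` (UNIV \<times> S))"
  shows "bounded (f n ` S)"
  by (rule bounded_subset[OF assms]) (auto intro!: image_eqI[where x="(n, _)"])

lemma bounded_linear_apply_comp:
  fixes A :: "'b \<Rightarrow> 'a::euclidean_space \<Rightarrow> 'c::real_normed_vector"
  assumes lin: "\<And>x. x \<in> S \<Longrightarrow> linear (A x)"
    and A: "\<And>b. b \<in> Basis \<Longrightarrow> bounded ((\<lambda>x. A x b) ` S)" and t: "bounded (t ` S)"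
  shows "bounded ((\<lambda>x. A x (t x)) ` S)"
proof -
  have "A x (t x) = (\<Sum>b\<in>Basis. (t x \<bullet> b) *\<^sub>R A x b)" if "x \<in> S" for x
  proof -
    have "A x (t x) = A x (\<Sum>b\<in>Basis. (t x \<bullet> b) *\<^sub>R b)" by (simp add: euclidean_representation)
    also have "\<dots> = (\<Sum>b\<in>Basis. (t x \<bullet> b) *\<^sub>R A x b)"
      using lin[OF that] by (simp add: linear_sum linear_cmul)
    finally show ?thesis .
  qed
  then have "(\<lambda>x. A x (t x)) ` S = (\<lambda>x. \<Sum>b\<in>Basis. (t x \<bullet> b) *\<^sub>R A x b) ` S"
    by (rule image_cong[OF refl])
  moreover have "bounded ((\<lambda>x. \<Sum>b\<in>I. (t x \<bullet> b) *\<^sub>R A x b) ` S)" if "I \<subseteq> Basis" for I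
    using finite_subset[OF that finite_Basis] that
  proof (induction I rule: finite_induct)
    case (insert b I)
    then show ?case
      by (simp, intro bounded_plus_comp bounded_scaleR_comp2 bounded_inner_comp t A bounded_const_comp) auto
  qed (simp add: bounded_const_comp)
  ultimately show ?thesis by simp
qed

text \<open>Admitting \<open>e = 0\<close> where a does not vanish lets one formula serve both the
  regularized field and the unit normal. The derivative of \<open>a / p\<close> is that of a with
  its component along \<open>a / p\<close> removed, divided by p.\<close>

lemma has_derivative_regularized_norm:
  fixes a :: "'a::real_inner \<Rightarrow> 'b::real_inner"
  assumes "(a has_derivative A) (at x)" "e \<noteq> 0 \<or> a x \<noteq> 0"
  defines "p \<equiv> \<lambda>x. sqrt ((norm (a x))\<^sup>2 + e\<^sup>2)"
  shows "(p has_derivative (\<lambda>v. (a x /\<^sub>R p x) \<bullet> A v)) (at x)"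
    "((\<lambda>x. a x /\<^sub>R p x) has_derivative
       (\<lambda>v. (1 / p x) *\<^sub>R (A v - ((a x /\<^sub>R p x) \<bullet> A v) *\<^sub>R (a x /\<^sub>R p x)))) (at x)"
proof -
  have pos: "p x > 0"
    using assms(2) by (auto simp: p_def intro: add_nonneg_pos add_pos_nonneg)
  have p: "p = (\<lambda>x. sqrt (a x \<bullet> a x + e\<^sup>2))"
    by (simp add: p_def power2_norm_eq_inner)
  have "(p has_derivative (\<lambda>v. (a x \<bullet> A v + A v \<bullet> a x + 0) * (inverse (p x) / 2))) (at x)"
    using pos unfolding p by (auto intro!: derivative_eq_intros assms(1))
  moreover have "(\<lambda>v. (a x \<bullet> A v + A v \<bullet> a x + 0) * (inverse (p x) / 2)) = (\<lambda>v. (a x /\<^sub>R p x) \<bullet> A v)"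
    by (auto simp: inner_commute fun_eq_iff)
  ultimately show 1: "(p has_derivative (\<lambda>v. (a x /\<^sub>R p x) \<bullet> A v)) (at x)"
    by (simp only:)
  show "((\<lambda>x. a x /\<^sub>R p x) has_derivative
       (\<lambda>v. (1 / p x) *\<^sub>R (A v - ((a x /\<^sub>R p x) \<bullet> A v) *\<^sub>R (a x /\<^sub>R p x)))) (at x)"
    using pos
    by (auto intro!: derivative_eq_intros assms(1) 1 simp: fun_eq_iff algebra_simps divide_simps power2_eq_square)
qed


text \<open>With \<open>a = \<nabla>u\<close>, \<open>A = D\<^sup>2u\<close>, \<open>g = \<nabla>\<omega>\<close> and \<open>t = a / p\<close>, this is the divergence of
  \<open>p \<omega> z - \<omega> (z \<bullet> a) t\<close> for \<open>p = sqrt (|a|\<^sup>2 + \<epsilon>\<^sup>2)\<close>. It stays bounded as \<open>\<epsilon>\<close> tends to 0, because the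
  factor \<open>a\<close> in \<open>z \<bullet> a\<close> absorbs the \<open>1/p\<close> from differentiating \<open>t\<close>. The limit \<open>p = |a|\<close>, \<open>t = sgn a\<close>
  is 0 at critical points.\<close>

definition flux_div :: "real \<Rightarrow> 'a \<Rightarrow> 'a \<Rightarrow> ('a \<Rightarrow> 'a) \<Rightarrow> real \<Rightarrow> 'a \<Rightarrow> 'a::euclidean_space \<Rightarrow> real" where
  "flux_div p t a A \<omega> g z = p * (g \<bullet> z + real DIM('a) * \<omega>) - ((g \<bullet> t) * (z \<bullet> a) + \<omega> * (t \<bullet> a))
     - \<omega> * (z \<bullet> t) * (lin_trace A - t \<bullet> A t)"

lemma bounded_flux_div:
  assumes lin: "\<And>x. x \<in> S \<Longrightarrow> linear (A x)"
    and A: "\<And>b. b \<in> Basis \<Longrightarrow> bounded ((\<lambda>x. A x b) ` S)"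
    and bd: "bounded (p ` S)" "bounded (t ` S)" "bounded (a ` S)" "bounded (\<omega> ` S)" "bounded (g ` S)" "bounded (z ` S)"
  shows "bounded ((\<lambda>x. flux_div (p x) (t x) (a x) (A x) (\<omega> x) (g x) (z x)) ` S)"
proof -
  have tr: "bounded ((\<lambda>x. lin_trace (A x)) ` S)"
    unfolding lin_trace_def
  proof -
    have "bounded ((\<lambda>x. \<Sum>b\<in>I. A x b \<bullet> b) ` S)" if "I \<subseteq> Basis" for I
      using finite_subset[OF that finite_Basis] that
      by (induction I rule: finite_induct)
        (auto intro!: bounded_const_comp bounded_plus_comp bounded_inner_comp A)
    then show "bounded ((\<lambda>x. \<Sum>b\<in>Basis. A x b \<bullet> b) ` S)" by blast
  qed
  have At: "bounded ((\<lambda>x. A x (t x)) ` S)"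
    by (rule bounded_linear_apply_comp[OF lin A bd(2)])
  show ?thesis
    unfolding flux_div_def
    by (intro bounded_minus_comp bounded_plus_comp bounded_mult_comp bounded_inner_comp bounded_const_comp
        bd tr At)
qed

text \<open>The weight \<omega>, with gradient g, stands for a squared test function already cut off
  near the boundary. For positive \<epsilon> the field is differentiable across critical points and
  supported in K, so its divergence integrates to 0; the bound on \<open>flux_div\<close> is uniform
  in \<epsilon>, which allows the limit.\<close>

theorem integral_flux_div_eq_0:
  fixes a g :: "'a::euclidean_space \<Rightarrow> 'a" and A :: "'a \<Rightarrow> 'a \<Rightarrow> 'a" and y :: 'a
  assumes \<Omega>: "open \<Omega>" "bounded \<Omega>" and K: "compact K" "K \<subseteq> \<Omega>"
    and da: "\<And>x. x \<in> \<Omega> \<Longrightarrow> (a has_derivative A x) (at x)"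
    and sym: "\<And>x v w. x \<in> \<Omega> \<Longrightarrow> A x v \<bullet> w = v \<bullet> A x w"
    and d\<omega>: "\<And>x. x \<in> \<Omega> \<Longrightarrow> (\<omega> has_derivative (\<lambda>v. g x \<bullet> v)) (at x)"
    and zero: "\<And>x. x \<in> \<Omega> \<Longrightarrow> x \<notin> K \<Longrightarrow> \<omega> x = 0"
    and ba: "bounded (a ` \<Omega>)" and bA: "\<And>b. b \<in> Basis \<Longrightarrow> bounded ((\<lambda>x. A x b) ` \<Omega>)"
    and b\<omega>: "bounded (\<omega> ` \<Omega>)" and bg: "bounded (g ` \<Omega>)"
  defines "Q \<equiv> \<lambda>x. indicator \<Omega> x * flux_div (norm (a x)) (sgn (a x)) (a x) (A x) (\<omega> x) (g x) (x - y)"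
  shows "integrable lborel Q" "integral\<^sup>L lborel Q = 0"
proof -
  define e where "e n = 1 / real (Suc n)" for n
  have e: "e n > 0" "e n \<le> 1" for n by (auto simp: e_def)
  define p where "p n x = sqrt ((norm (a x))\<^sup>2 + (e n)\<^sup>2)" for n x
  define t where "t n x = a x /\<^sub>R p n x" for n x
  define G where "G n x = flux_div (p n x) (t n x) (a x) (A x) (\<omega> x) (g x) (x - y)" for n x
  have pos: "p n x > 0" for n x
    using e(1)[of n] by (auto simp: p_def intro!: add_nonneg_pos)
  have pa: "norm (a x) \<le> p n x" for n x
    unfolding p_def by (rule real_le_rsqrt) simp
  have ep: "e n \<le> p n x" for n x
    unfolding p_def by (rule real_le_rsqrt) simp
  have nt: "norm (t n x) \<le> 1" for n x
    using pa[of x n] pos[of n x] by (simp add: t_def field_simps)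
  have lin: "linear (A x)" if "x \<in> \<Omega>" for x
    using da[OF that] has_derivative_linear by blast
  have bz: "bounded ((\<lambda>x. x - y) ` \<Omega>)"
    using \<Omega>(2) by (intro bounded_minus_comp bounded_const_comp) simp
  obtain M where M: "\<And>x. x \<in> \<Omega> \<Longrightarrow> norm (a x) \<le> M" using ba by (auto simp: bounded_iff)
  have pM: "p n x \<le> M + 1" if "x \<in> \<Omega>" for n x
  proof -
    have "p n x \<le> norm (a x) + e n"
      unfolding p_def using sqrt_sum_squares_le_sum[of "norm (a x)" "e n"] e(1)[of n] by simp
    then show ?thesis using M[OF that] e(2)[of n] by linarith
  qed
  have bp: "bounded ((\<lambda>q. p (fst q) (snd q)) ` (UNIV \<times> \<Omega>))"
    unfolding bounded_iff using pM pos by (intro exI[of _ "M + 1"]) (auto simp: abs_of_pos)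
  have bt: "bounded ((\<lambda>q. t (fst q) (snd q)) ` (UNIV \<times> \<Omega>))"
    unfolding bounded_iff using nt by (intro exI[of _ 1]) auto
  have "bounded ((\<lambda>q. G (fst q) (snd q)) ` (UNIV \<times> \<Omega>))"
    unfolding G_def
    by (rule bounded_flux_div[where A="\<lambda>q. A (snd q)", OF _ bounded_snd_comp[OF bA] bp bt bounded_snd_comp[OF ba]
          bounded_snd_comp[OF b\<omega>] bounded_snd_comp[OF bg] bounded_snd_comp[OF bz]])
      (auto intro: lin)
  then obtain C where C: "\<And>n x. x \<in> \<Omega> \<Longrightarrow> \<bar>G n x\<bar> \<le> C"
    unfolding bounded_iff by fastforce
  have IG: "integrable lborel (\<lambda>x. indicator \<Omega> x * G n x) \<and> (\<integral>x. indicator \<Omega> x * G n x \<partial>lborel) = 0" for n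
  proof -
    have bpn: "bounded (p n ` \<Omega>)" and btn: "bounded (t n ` \<Omega>)"
      using bounded_fst_slice[OF bp] bounded_fst_slice[OF bt] .
    \<comment> \<open>This bound depends on n; it only serves the divergence theorem for fixed n.
      Domination along the sequence uses C, which is free of \<open>1 / p\<close>.\<close>
    have bin: "bounded ((\<lambda>x. 1 / p n x) ` \<Omega>)"
      unfolding bounded_iff
    proof (intro exI[of _ "1 / e n"] ballI, clarsimp)
      fix x show "1 / \<bar>p n x\<bar> \<le> 1 / e n"
        using ep[of n x] e(1)[of n] pos[of n x] by (simp add: frac_le)
    qed
    define z where "z x = x - y" for x
    define F where "F x = (p n x * \<omega> x) *\<^sub>R z x - (\<omega> x * (z x \<bullet> a x)) *\<^sub>R t n x" for x
    define D where "D x v = ((p n x * (g x \<bullet> v) + \<omega> x * (t n x \<bullet> A x v)) *\<^sub>R z x + (p n x * \<omega> x) *\<^sub>R v)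
      - (((g x \<bullet> v) * (z x \<bullet> a x) + \<omega> x * (v \<bullet> a x + z x \<bullet> A x v)) *\<^sub>R t n x
        + (\<omega> x * (z x \<bullet> a x)) *\<^sub>R ((1 / p n x) *\<^sub>R (A x v - (t n x \<bullet> A x v) *\<^sub>R t n x)))" for x v
    have dF: "(F has_derivative D x) (at x)" if x: "x \<in> \<Omega>" for x
    proof -
      have 1: "(p n has_derivative (\<lambda>v. t n x \<bullet> A x v)) (at x)"
        and 2: "(t n has_derivative (\<lambda>v. (1 / p n x) *\<^sub>R (A x v - (t n x \<bullet> A x v) *\<^sub>R t n x))) (at x)"
        using has_derivative_regularized_norm[OF da[OF x], of "e n"] e(1)[of n]
        unfolding t_def p_def by auto
      have 3: "(z has_derivative (\<lambda>v. v)) (at x)"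
        unfolding z_def by (auto intro!: derivative_eq_intros)
      show ?thesis
        unfolding F_def D_def
        by (rule derivative_eq_intros 1 2 3 da[OF x] d\<omega>[OF x] refl)+
          (auto simp: fun_eq_iff algebra_simps inner_commute)
    qed
    have tr: "lin_trace (D x) = G n x" if x: "x \<in> \<Omega>" for x
    proof -
      have l: "linear (\<lambda>v. p n x * (g x \<bullet> v) + \<omega> x * (t n x \<bullet> A x v))"
         "linear (\<lambda>v. (g x \<bullet> v) * (z x \<bullet> a x) + \<omega> x * (v \<bullet> a x + z x \<bullet> A x v))"
         "linear (\<lambda>v. t n x \<bullet> A x v)"
        using linear_add[OF lin[OF x]] linear_cmul[OF lin[OF x]]
        by (auto intro!: linearI simp: algebra_simps inner_add_left inner_add_right)
      have at: "a x = p n x *\<^sub>R t n x" using pos[of n x] by (simp add: t_def)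
      have "lin_trace (D x) = (p n x * (g x \<bullet> z x) + \<omega> x * (t n x \<bullet> A x (z x)) + p n x * \<omega> x * real DIM('a))
       - ((g x \<bullet> t n x) * (z x \<bullet> a x) + \<omega> x * (t n x \<bullet> a x + z x \<bullet> A x (t n x))
          + (\<omega> x * (z x \<bullet> a x)) * ((1 / p n x) * (lin_trace (A x) - t n x \<bullet> A x (t n x))))"
        unfolding D_def lin_trace_diff lin_trace_add lin_trace_scaleR lin_trace_ident
          lin_trace_rank_one[OF l(1)] lin_trace_rank_one[OF l(2)] lin_trace_rank_one[OF l(3)] by simp
      also have "(\<omega> x * (z x \<bullet> a x)) * ((1 / p n x) * c) = \<omega> x * (z x \<bullet> t n x) * c" for c
        using pos[of n x] by (simp add: at)
      \<comment> \<open>By symmetry of A, the term from differentiating p cancels the one from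
        differentiating a in \<open>z \<bullet> a\<close>.\<close>
      also have "t n x \<bullet> A x (z x) = z x \<bullet> A x (t n x)"
        using sym[OF x] by (metis inner_commute)
      finally show ?thesis
        unfolding G_def flux_div_def z_def[symmetric] by (simp add: algebra_simps)
    qed
    have bD: "bounded ((\<lambda>x. D x b \<bullet> b) ` \<Omega>)" if "b \<in> Basis" for b
      unfolding D_def
      by (intro bounded_inner_comp bounded_minus_comp bounded_plus_comp bounded_scaleR_comp2 bounded_mult_comp
          bounded_const_comp bpn btn ba b\<omega> bg bA[OF that] bz[folded z_def] bin)
    have F0: "F x = 0" if "x \<in> \<Omega>" "x \<notin> K" for x
      using zero[OF that] by (simp add: F_def)
    have eq: "indicator \<Omega> x * lin_trace (D x) = indicator \<Omega> x * G n x" for x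
      using tr[of x] by (cases "x \<in> \<Omega>") auto
    show ?thesis
      using integral_divergence_eq_0[of \<Omega> K F D, OF \<Omega> K dF bD F0] unfolding eq by blast
  qed
  have lim: "(\<lambda>n. indicator \<Omega> x * G n x) \<longlonglongrightarrow> Q x" for x
  proof (cases "x \<in> \<Omega>")
    case True
    have "(\<lambda>n. e n) \<longlonglongrightarrow> 0" unfolding e_def by (rule LIMSEQ_Suc[OF lim_1_over_n])
    then have "(\<lambda>n. p n x) \<longlonglongrightarrow> sqrt ((norm (a x))\<^sup>2 + 0\<^sup>2)"
      unfolding p_def by (intro tendsto_intros)
    then have p: "(\<lambda>n. p n x) \<longlonglongrightarrow> norm (a x)" by simp
    \<comment> \<open>At a critical point \<open>t n x\<close> is 0 for every n, in agreement with
      \<open>sgn 0 = 0\<close>.\<close>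
    have t: "(\<lambda>n. t n x) \<longlonglongrightarrow> sgn (a x)"
    proof (cases "a x = 0")
      case False
      then show ?thesis unfolding t_def sgn_div_norm by (intro tendsto_intros p) simp
    qed (simp add: t_def)
    have At: "(\<lambda>n. A x (t n x)) \<longlonglongrightarrow> A x (sgn (a x))"
      using has_derivative_bounded_linear[OF da[OF True]] t bounded_linear.tendsto by blast
    show ?thesis
      unfolding Q_def G_def flux_div_def by (intro tendsto_intros p t At)
  qed (simp add: Q_def)
  have "\<bar>indicator \<Omega> x * G n x\<bar> \<le> \<bar>C\<bar> * indicator \<Omega> x" for x n
    using C[of x n] by (auto simp: indicator_def)
  then have bd: "AE x in lborel. norm (indicator \<Omega> x * G n x) \<le> \<bar>C\<bar> * indicator \<Omega> x" for n by simp
  have m: "(\<lambda>x. indicator \<Omega> x * G n x) \<in> borel_measurable lborel" for n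
    using IG by blast
  have mQ: "Q \<in> borel_measurable lborel"
    by (rule borel_measurable_LIMSEQ_real[OF lim m])
  have iw: "integrable lborel (\<lambda>x::'a. \<bar>C\<bar> * indicator \<Omega> x)"
    using \<Omega> emeasure_bounded_finite[OF \<Omega>(2)]
    by (intro integrable_mult_right integrable_real_indicator) (auto simp: less_top)
  show "integrable lborel Q"
    by (rule integrable_dominated_convergence[where s="\<lambda>n x. indicator \<Omega> x * G n x", OF mQ m iw _ bd]) (simp add: lim)
  have "(\<lambda>n. \<integral>x. indicator \<Omega> x * G n x \<partial>lborel) \<longlonglongrightarrow> integral\<^sup>L lborel Q"
    by (rule integral_dominated_convergence[where s="\<lambda>n x. indicator \<Omega> x * G n x", OF mQ m iw _ bd]) (simp add: lim)
  then show "integral\<^sup>L lborel Q = 0"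
    using IG by (simp add: LIMSEQ_const_iff)
qed

subsection \<open>Gradient, Hessian and mean curvature\<close>

lemma inner_grad:
  fixes f :: "'a::euclidean_space \<Rightarrow> real"
  assumes "(f has_derivative D) (at x)"
  shows "grad f x \<bullet> v = D v"
proof -
  have "D v = D (\<Sum>b\<in>Basis. (v \<bullet> b) *\<^sub>R b)" by (simp add: euclidean_representation)
  also have "\<dots> = (\<Sum>b\<in>Basis. (v \<bullet> b) * D b)"
    using has_derivative_linear[OF assms] by (simp add: linear_sum linear_cmul)
  finally show ?thesis
    unfolding grad_def frechet_derivative_at[OF assms, symmetric]
    by (simp add: inner_sum_left mult.commute inner_commute[of v])
qed

lemma has_derivative_grad:
  fixes f :: "'a::euclidean_space \<Rightarrow> real"
  assumes "f differentiable (at x)"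
  shows "(f has_derivative (\<lambda>v. grad f x \<bullet> v)) (at x)"
  using assms inner_grad unfolding differentiable_def by (metis (no_types, lifting) ext)

lemma grad_eqI:
  assumes "(f has_derivative (\<lambda>v. g \<bullet> v)) (at x)"
  shows "grad f x = g"
  by (rule vector_eq_ldot[THEN iffD1]) (simp add: inner_grad[OF assms] inner_commute[of _ "grad f x"] inner_commute[of _ g])

text \<open>Written with \<open>iter_partial\<close> because \<open>smooth_on\<close> supplies
  differentiability and continuity of exactly these entries.\<close>

definition hess :: "('a::euclidean_space \<Rightarrow> real) \<Rightarrow> 'a \<Rightarrow> 'a \<Rightarrow> 'a" where
  "hess u x v = (\<Sum>b\<in>Basis. frechet_derivative (iter_partial [b] u) (at x) v *\<^sub>R b)"

lemma smooth_on_differentiable: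
  assumes "open U" "smooth_on U u" "x \<in> U" "set vs \<subseteq> Basis"
  shows "iter_partial vs u differentiable (at x)"
  using assms by (auto simp: smooth_on_def differentiable_on_eq_differentiable_at)

lemma smooth_on_continuous:
  assumes "smooth_on U u" "set vs \<subseteq> Basis"
  shows "continuous_on U (iter_partial vs u)"
  using assms by (auto simp: smooth_on_def intro: differentiable_imp_continuous_on)

lemma has_derivative_grad_hess:
  assumes "open U" "smooth_on U u" "x \<in> U"
  shows "(grad u has_derivative hess u x) (at x)"
proof -
  have g: "grad u = (\<lambda>x. \<Sum>b\<in>Basis. iter_partial [b] u x *\<^sub>R b)"
    by (simp add: grad_def fun_eq_iff)
  show ?thesis
    unfolding g hess_def
    using smooth_on_differentiable[OF assms, of "[_]"]
    by (intro has_derivative_sum has_derivative_scaleR_left) (auto simp: frechet_derivative_works)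
qed

lemma continuous_on_grad:
  assumes "smooth_on U u"
  shows "continuous_on U (grad u)"
proof -
  have g: "grad u = (\<lambda>x. \<Sum>b\<in>Basis. iter_partial [b] u x *\<^sub>R b)"
    by (simp add: grad_def fun_eq_iff)
  show ?thesis unfolding g
    using smooth_on_continuous[OF assms, of "[_]"] by (intro continuous_intros) auto
qed

lemma hess_Basis: "hess u x c = (\<Sum>b\<in>Basis. iter_partial [c, b] u x *\<^sub>R b)"
  by (simp add: hess_def)

lemma hess_Basis_inner: "b \<in> Basis \<Longrightarrow> hess u x c \<bullet> b = iter_partial [c, b] u x"
  by (simp add: hess_def inner_sum_left inner_Basis if_distrib cong: if_cong)

lemma continuous_on_hess:
  assumes "smooth_on U u" "c \<in> Basis"
  shows "continuous_on U (\<lambda>x. hess u x c)"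
  unfolding hess_Basis
  using smooth_on_continuous[OF assms(1), of "[c, _]"] assms(2)
  by (intro continuous_intros) auto

lemma hess_symmetric:
  assumes "open U" "smooth_on U u" "x \<in> U"
  shows "hess u x v \<bullet> w = v \<bullet> hess u x w"
proof -
  have lin: "linear (hess u x)"
    using has_derivative_grad_hess[OF assms] has_derivative_linear by blast
  \<comment> \<open>\<open>smooth_on\<close> controls iterated derivatives along basis vectors only,
    so mixed derivatives are exchanged there and the result is extended bilinearly.\<close>
  have *: "hess u x c \<bullet> b = c \<bullet> hess u x b" if "b \<in> Basis" "c \<in> Basis" for b c
  proof -
    have "frechet_derivative (iter_partial [b] u) (at x) c = frechet_derivative (iter_partial [c] u) (at x) b"
    proof (rule mixed_derivatives_commute[where f=u and D="\<lambda>p. frechet_derivative u (at p)", OF assms(1,3)])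
      fix p assume p: "p \<in> U"
      show "(u has_derivative frechet_derivative u (at p)) (at p)"
        using smooth_on_differentiable[OF assms(1,2) p, of "[]"] by (simp add: frechet_derivative_works)
      show "((\<lambda>p. frechet_derivative u (at p) b) has_derivative frechet_derivative (iter_partial [b] u) (at p)) (at p)"
        using smooth_on_differentiable[OF assms(1,2) p, of "[b]"] that by (simp add: frechet_derivative_works)
      show "((\<lambda>p. frechet_derivative u (at p) c) has_derivative frechet_derivative (iter_partial [c] u) (at p)) (at p)"
        using smooth_on_differentiable[OF assms(1,2) p, of "[c]"] that by (simp add: frechet_derivative_works)
    next
      have "continuous_on U (iter_partial [c, b] u)" "continuous_on U (iter_partial [b, c] u)"
        by (rule smooth_on_continuous[OF assms(2)]; use that in simp)+
      then show "isCont (\<lambda>p. frechet_derivative (iter_partial [b] u) (at p) c) x"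
        "isCont (\<lambda>p. frechet_derivative (iter_partial [c] u) (at p) b) x"
        using assms by (auto simp: continuous_on_eq_continuous_at)
    qed
    then show ?thesis
      using that by (simp add: hess_Basis_inner inner_commute[of c])
  qed
  have e: "hess u x v = (\<Sum>c\<in>Basis. (v \<bullet> c) *\<^sub>R hess u x c)" for v
  proof -
    have "hess u x v = hess u x (\<Sum>c\<in>Basis. (v \<bullet> c) *\<^sub>R c)" by (simp add: euclidean_representation)
    then show ?thesis using lin by (simp add: linear_sum linear_cmul)
  qed
  have "hess u x v \<bullet> w = (\<Sum>c\<in>Basis. (v \<bullet> c) * (hess u x c \<bullet> w))"
    by (subst e) (simp add: inner_sum_left)
  also have "\<dots> = (\<Sum>c\<in>Basis. (v \<bullet> c) * (c \<bullet> hess u x w))"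
  proof (rule sum.cong[OF refl])
    fix c :: 'a assume c: "c \<in> Basis"
    have "hess u x c \<bullet> w = (\<Sum>b\<in>Basis. (w \<bullet> b) * (hess u x c \<bullet> b))"
      by (subst euclidean_inner) (simp add: mult.commute)
    also have "\<dots> = (\<Sum>b\<in>Basis. (w \<bullet> b) * (c \<bullet> hess u x b))"
      using * c by simp
    also have "\<dots> = c \<bullet> hess u x w"
      by (subst (2) e) (simp add: inner_sum_right)
    finally show "(v \<bullet> c) * (hess u x c \<bullet> w) = (v \<bullet> c) * (c \<bullet> hess u x w)" by simp
  qed
  also have "\<dots> = v \<bullet> hess u x w"
    by (subst euclidean_inner) (simp add: inner_commute)
  finally show ?thesis .
qed

lemma unit_normal_eq_sgn: "unit_normal u x = sgn (grad u x)"
  by (simp add: unit_normal_def sgn_div_norm inverse_eq_divide)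

text \<open>The case \<open>e = 0\<close> of \<open>has_derivative_regularized_norm\<close>, after
  taking traces. Multiplied by |grad u|, it is exactly the last factor of
  \<open>flux_div\<close>.\<close>

lemma mean_curv_eq:
  assumes "open U" "smooth_on U u" "x \<in> U" "grad u x \<noteq> 0"
  shows "norm (grad u x) * mean_curv u x
    = lin_trace (hess u x) - unit_normal u x \<bullet> hess u x (unit_normal u x)"
proof -
  let ?N = "norm (grad u x)" and ?\<nu> = "unit_normal u x"
  have \<nu>: "unit_normal u = (\<lambda>x. grad u x /\<^sub>R norm (grad u x))"
    by (simp add: unit_normal_def fun_eq_iff inverse_eq_divide)
  have "(unit_normal u has_derivative (\<lambda>v. (1 / ?N) *\<^sub>R (hess u x v - (?\<nu> \<bullet> hess u x v) *\<^sub>R ?\<nu>))) (at x)"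
    using has_derivative_regularized_norm(2)[OF has_derivative_grad_hess[OF assms(1-3)], of 0] assms(4)
    unfolding \<nu> by simp
  moreover have "linear (\<lambda>v. ?\<nu> \<bullet> hess u x v)"
    using has_derivative_linear[OF has_derivative_grad_hess[OF assms(1-3)]]
    by (auto intro!: linearI simp: linear_add linear_cmul inner_add_right)
  ultimately have "mean_curv u x = (1 / ?N) * (lin_trace (hess u x) - ?\<nu> \<bullet> hess u x ?\<nu>)"
    unfolding mean_curv_def
    by (simp only: divergence_eq_lin_trace lin_trace_scaleR lin_trace_diff lin_trace_rank_one)
  then show ?thesis using assms(4) by simp
qed

lemma flux_div_eq_0: "flux_div 0 0 0 A \<omega> g z = 0"
  by (simp add: flux_div_def)

text \<open>Removing the normal direction turns the trace \<open>n\<close> into \<open>n - 1\<close>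
  and the gradient of \<phi> into its tangential part. At a critical point both sides are 0,
  whatever value \<open>mean_curv\<close> takes there.\<close>

lemma flux_div_mean_curv:
  fixes u \<phi> :: "'a::euclidean_space \<Rightarrow> real"
  assumes "open U" "smooth_on U u" "x \<in> U"
  shows "flux_div (norm (grad u x)) (sgn (grad u x)) (grad u x) (hess u x) ((\<phi> x)\<^sup>2) ((2 * \<phi> x) *\<^sub>R grad \<phi> x) z
    = norm (grad u x) * ((real DIM('a) - 1) * (\<phi> x)\<^sup>2 + 2 * \<phi> x * (tan_grad u \<phi> x \<bullet> z)
        - (\<phi> x)\<^sup>2 * mean_curv u x * (unit_normal u x \<bullet> z))"
proof (cases "grad u x = 0")
  case False
  define N where "N = norm (grad u x)"
  have a: "grad u x = N *\<^sub>R unit_normal u x" "unit_normal u x \<bullet> unit_normal u x = 1"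
    using False by (auto simp: unit_normal_def N_def dot_square_norm power2_eq_square)
  have "flux_div N (unit_normal u x) (grad u x) (hess u x) ((\<phi> x)\<^sup>2) ((2 * \<phi> x) *\<^sub>R grad \<phi> x) z
    = N * ((real DIM('a) - 1) * (\<phi> x)\<^sup>2 + 2 * \<phi> x * (tan_grad u \<phi> x \<bullet> z)) - (\<phi> x)\<^sup>2 * (z \<bullet> unit_normal u x) * (N * mean_curv u x)"
    unfolding flux_div_def mean_curv_eq[OF assms False, folded N_def] unfolding a(1) tan_grad_def
    by (simp add: a(2) algebra_simps inner_commute)
  then show ?thesis
    unfolding unit_normal_eq_sgn[symmetric] N_def by (simp add: algebra_simps inner_commute)
qed (simp add: flux_div_eq_0)

section \<open>Truncated squares\<close>

definition sqpos :: "real \<Rightarrow> real" where "sqpos t = (max 0 t)\<^sup>2"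

lemma DERIV_sqpos: "(sqpos has_real_derivative 2 * max 0 t) (at t)"
proof -
  consider "t > 0" | "t < 0" | "t = 0" by linarith
  then show ?thesis
  proof cases
    case 1
    have "((\<lambda>t. t\<^sup>2) has_real_derivative 2 * max 0 t) (at t)"
      using 1 by (auto intro!: derivative_eq_intros)
    then show ?thesis
      by (rule has_field_derivative_transform_within_open[of _ _ _ "{0<..}"]) (use 1 in \<open>auto simp: sqpos_def\<close>)
  next
    case 2
    have "((\<lambda>t. 0) has_real_derivative 2 * max 0 t) (at t)"
      using 2 by (auto intro!: derivative_eq_intros)
    then show ?thesis
      by (rule has_field_derivative_transform_within_open[of _ _ _ "{..<0}"]) (use 2 in \<open>auto simp: sqpos_def\<close>)
  next
    case 3
    have "((\<lambda>h. max 0 h) \<longlongrightarrow> max 0 (0::real)) (at 0)" by (intro tendsto_intros)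
    moreover have "max 0 h = (sqpos h - sqpos 0) / (h - 0)" if "h \<noteq> 0" for h :: real
      using that by (auto simp: sqpos_def max_def power2_eq_square)
    ultimately have "((\<lambda>h. (sqpos h - sqpos 0) / (h - 0)) \<longlongrightarrow> 0) (at 0)"
      by (auto elim!: Lim_transform_eventually simp: eventually_at_filter)
    then show ?thesis using 3 by (simp add: has_field_derivative_iff)
  qed
qed

text \<open>A continuously differentiable substitute for the square that vanishes for
  \<open>\<bar>t\<bar> \<le> \<delta>\<close>. Composed with a function that is 0 on the boundary of
  \<Omega>, it has compact support in \<Omega>; value and derivative are dominated by those of the
  square, uniformly in \<delta>.\<close>

definition trunc_sq :: "real \<Rightarrow> real \<Rightarrow> real" where
  "trunc_sq \<delta> t = sqpos (t - \<delta>) + sqpos (- t - \<delta>)"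

definition trunc_sq' :: "real \<Rightarrow> real \<Rightarrow> real" where
  "trunc_sq' \<delta> t = 2 * max 0 (t - \<delta>) - 2 * max 0 (- t - \<delta>)"

lemma DERIV_trunc_sq: "(trunc_sq \<delta> has_real_derivative trunc_sq' \<delta> t) (at t)"
  unfolding trunc_sq_def[abs_def] trunc_sq'_def
  by (auto intro!: derivative_eq_intros DERIV_chain2[OF DERIV_sqpos])

lemma trunc_sq_nonneg: "0 \<le> trunc_sq \<delta> t"
  by (simp add: trunc_sq_def sqpos_def)

lemma trunc_sq_eq_0: "\<bar>t\<bar> \<le> \<delta> \<Longrightarrow> trunc_sq \<delta> t = 0"
  by (cases "t = \<delta>"; cases "- t = \<delta>") (auto simp: trunc_sq_def sqpos_def max_def)

lemma trunc_sq_le: "0 \<le> \<delta> \<Longrightarrow> trunc_sq \<delta> t \<le> t\<^sup>2"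
  using abs_le_square_iff[of "t - \<delta>" t] abs_le_square_iff[of "- t - \<delta>" t]
  by (cases "t = 0 \<and> \<delta> = 0") (auto simp: trunc_sq_def sqpos_def max_def)

lemma trunc_sq'_le: "0 \<le> \<delta> \<Longrightarrow> \<bar>trunc_sq' \<delta> t\<bar> \<le> 2 * \<bar>t\<bar>"
  by (auto simp: trunc_sq'_def max_def)

lemma tendsto_trunc_sq:
  assumes "(\<delta> \<longlongrightarrow> 0) F"
  shows "((\<lambda>n. trunc_sq (\<delta> n) t) \<longlongrightarrow> t\<^sup>2) F" "((\<lambda>n. trunc_sq' (\<delta> n) t) \<longlongrightarrow> 2 * t) F"
proof -
  have "((\<lambda>n. trunc_sq (\<delta> n) t) \<longlongrightarrow> (max 0 (t - 0))\<^sup>2 + (max 0 (- t - 0))\<^sup>2) F"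
    unfolding trunc_sq_def sqpos_def by (intro tendsto_intros assms)
  moreover have "(max 0 (t - 0))\<^sup>2 + (max 0 (- t - 0))\<^sup>2 = t\<^sup>2" by (auto simp: max_def)
  ultimately show "((\<lambda>n. trunc_sq (\<delta> n) t) \<longlongrightarrow> t\<^sup>2) F" by simp
  have "((\<lambda>n. trunc_sq' (\<delta> n) t) \<longlongrightarrow> 2 * max 0 (t - 0) - 2 * max 0 (- t - 0)) F"
    unfolding trunc_sq'_def by (intro tendsto_intros assms)
  moreover have "2 * max 0 (t - 0) - 2 * max 0 (- t - 0) = 2 * t" by (auto simp: max_def)
  ultimately show "((\<lambda>n. trunc_sq' (\<delta> n) t) \<longlongrightarrow> 2 * t) F" by simp
qed

subsection \<open>The set where a smooth function vanishes\<close>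

text \<open>The neighbourhood U of the closure makes the derivatives of u continuous on a compact
  set, hence bounded on \<Omega>; all dominating constants for u come from there.\<close>

locale level_sets =
  fixes \<Omega> U :: "'a::euclidean_space set" and u :: "'a \<Rightarrow> real"
  assumes open_\<Omega>: "open \<Omega>" and bounded_\<Omega>: "bounded \<Omega>"
    and open_U: "open U" and closure_subset_U: "closure \<Omega> \<subseteq> U"
    and smooth: "smooth_on U u"
begin

lemma \<Omega>_subset: "\<Omega> \<subseteq> U"
  using closure_subset_U closure_subset by blast

lemma measurable_\<Omega> [measurable]: "\<Omega> \<in> sets borel"
  using open_\<Omega> by simp

lemma bounded_image: "continuous_on V f \<Longrightarrow> closure \<Omega> \<subseteq> V \<Longrightarrow> bounded (f ` \<Omega>)"
  using compact_imp_bounded[OF compact_continuous_image[of "closure \<Omega>" f]] bounded_\<Omega>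
  by (meson closure_subset bounded_subset compact_closure continuous_on_subset image_mono)

lemma integrable_const_indicator: "integrable lborel (\<lambda>x::'a. c * indicator \<Omega> x :: real)"
  using emeasure_bounded_finite[OF bounded_\<Omega>]
  by (intro integrable_mult_right integrable_real_indicator) (auto simp: less_top)

lemma bounded_grad: "bounded (grad u ` \<Omega>)"
  using bounded_image[OF continuous_on_grad[OF smooth] closure_subset_U] .

lemma bounded_hess: "b \<in> Basis \<Longrightarrow> bounded ((\<lambda>x. hess u x b) ` \<Omega>)"
  using bounded_image[OF continuous_on_hess[OF smooth] closure_subset_U] .

lemma continuous_on_u: "continuous_on U u"
  using smooth_on_continuous[OF smooth, of "[]"] by simp

lemma bounded_u: "bounded (u ` \<Omega>)"
  using bounded_image[OF continuous_on_u closure_subset_U] .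

lemma has_derivative_u: "x \<in> \<Omega> \<Longrightarrow> (u has_derivative (\<lambda>v. grad u x \<bullet> v)) (at x)"
  using smooth_on_differentiable[OF open_U smooth, of x "[]"] \<Omega>_subset by (auto intro: has_derivative_grad)

lemma has_derivative_grad_u: "x \<in> \<Omega> \<Longrightarrow> (grad u has_derivative hess u x) (at x)"
  using has_derivative_grad_hess[OF open_U smooth] \<Omega>_subset by auto

lemma linear_hess: "x \<in> \<Omega> \<Longrightarrow> linear (hess u x)"
  using has_derivative_grad_u has_derivative_linear by blast

lemma bounded_trace_hess: "bounded ((\<lambda>x. lin_trace (hess u x)) ` \<Omega>)"
proof -
  have "continuous_on U (\<lambda>x. lin_trace (hess u x))"
    unfolding lin_trace_def by (intro continuous_intros continuous_on_hess[OF smooth])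
  then show ?thesis using bounded_image closure_subset_U by blast
qed

text \<open>Test the divergence theorem with \<open>\<eta> (arctan (k u) / k) \<nabla>u\<close>, where \<open>\<eta>\<close> is a cutoff: as
  \<open>k\<close> grows, only the integral of \<open>\<eta> |\<nabla>u|\<^sup>2\<close> over the zero set of \<open>u\<close> survives.\<close>

lemma AE_grad_eq_0_on_zero_set:
  assumes \<rho>: "smooth_on UNIV \<rho>" and \<Omega>_eq: "\<Omega> = {x. \<rho> x < 0}"
  shows "AE x in lborel. x \<in> \<Omega> \<and> u x = 0 \<longrightarrow> grad u x = 0"
proof -
  have c\<rho>: "continuous_on UNIV \<rho>" using smooth_on_continuous[OF \<rho>, of "[]"] by simp
  have d\<rho>: "(\<rho> has_derivative (\<lambda>v. grad \<rho> x \<bullet> v)) (at x)" for x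
    using smooth_on_differentiable[OF open_UNIV \<rho>, of x "[]"] by (auto intro: has_derivative_grad)
  have b\<rho>: "bounded (\<rho> ` \<Omega>)" "bounded (grad \<rho> ` \<Omega>)"
    using bounded_image[OF c\<rho>] bounded_image[OF continuous_on_grad[OF \<rho>]] by auto
  \<comment> \<open>The function \<eta> below is positive in \<Omega> exactly where
    \<open>\<rho> x < - \<delta>\<close>, so the test field has compact support in \<Omega>. The
    choices \<open>\<delta> = 1 / Suc n\<close> exhaust \<Omega> at the end.\<close>
  have AE_\<delta>: "AE x in lborel. x \<in> \<Omega> \<and> \<rho> x < - \<delta> \<and> u x = 0 \<longrightarrow> grad u x = 0" if "\<delta> > 0" for \<delta>
  proof -
    define \<eta> where "\<eta> x = sqpos (- \<rho> x - \<delta>)" for x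
    define \<eta>' where "\<eta>' x = - 2 * max 0 (- \<rho> x - \<delta>)" for x
    \<comment> \<open>\<open>\<theta> n\<close> tends to 0 uniformly, being at most
      \<open>2 / Suc n\<close>, while its derivative \<open>\<kappa> n\<close> with respect to u
      lies between 0 and 1 and tends to the indicator of the zero set. Only the middle term of G,
      the divergence of \<open>\<eta> \<theta>\<close> times the gradient of u, survives.\<close>
    define \<theta> where "\<theta> n x = arctan (real (Suc n) * u x) / real (Suc n)" for n x
    define \<kappa> where "\<kappa> n x = 1 / (1 + (real (Suc n) * u x)\<^sup>2)" for n x
    define G where "G n x = \<eta>' x * \<theta> n x * (grad \<rho> x \<bullet> grad u x) + \<eta> x * \<kappa> n x * (norm (grad u x))\<^sup>2
      + \<eta> x * \<theta> n x * lin_trace (hess u x)" for n x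
    define L where "L x = indicator \<Omega> x * (\<eta> x * (if u x = 0 then 1 else 0) * (norm (grad u x))\<^sup>2)" for x
    have b\<eta>: "bounded (\<eta> ` \<Omega>)" "bounded (\<eta>' ` \<Omega>)"
      unfolding \<eta>_def \<eta>'_def sqpos_def
      by (rule bounded_image[where V=UNIV], intro continuous_intros c\<rho>, simp)+
    have \<theta>_le: "\<bar>\<theta> n x\<bar> \<le> 2 / real (Suc n)" for n x
    proof -
      have "\<bar>arctan (real (Suc n) * u x)\<bar> \<le> 2"
        using arctan_ubound[of "real (Suc n) * u x"] arctan_lbound[of "real (Suc n) * u x"] pi_less_4 by linarith
      then show ?thesis by (simp add: \<theta>_def divide_right_mono)
    qed
    have \<theta>_le2: "\<bar>\<theta> n x\<bar> \<le> 2" for n x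
      using \<theta>_le[of n x] by (rule order_trans) (simp add: field_simps)
    have b\<theta>: "bounded ((\<lambda>q. \<theta> (fst q) (snd q)) ` (UNIV \<times> \<Omega>))"
      unfolding bounded_iff using \<theta>_le2 by auto
    have b\<kappa>: "bounded ((\<lambda>q. \<kappa> (fst q) (snd q)) ` (UNIV \<times> \<Omega>))"
      unfolding bounded_iff \<kappa>_def by (intro exI[of _ 1]) (auto simp: divide_simps add_pos_nonneg)
    have bN: "bounded ((\<lambda>x. (norm (grad u x))\<^sup>2) ` \<Omega>)"
      unfolding power2_norm_eq_inner by (intro bounded_inner_comp bounded_grad)
    have "bounded ((\<lambda>q. G (fst q) (snd q)) ` (UNIV \<times> \<Omega>))"
      unfolding G_def
      by (intro bounded_plus_comp bounded_mult_comp bounded_inner_comp b\<theta> b\<kappa>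
          bounded_snd_comp[OF b\<eta>(1)] bounded_snd_comp[OF b\<eta>(2)] bounded_snd_comp[OF bN]
          bounded_snd_comp[OF b\<rho>(2)] bounded_snd_comp[OF bounded_grad] bounded_snd_comp[OF bounded_trace_hess])
    then obtain C where C: "\<And>n x. x \<in> \<Omega> \<Longrightarrow> \<bar>G n x\<bar> \<le> C"
      unfolding bounded_iff by fastforce
    have K: "compact {x \<in> closure \<Omega>. \<rho> x \<le> - \<delta>}" "{x \<in> closure \<Omega>. \<rho> x \<le> - \<delta>} \<subseteq> \<Omega>"
    proof -
      have "closed {x. \<rho> x \<le> - \<delta>}"
        using c\<rho> by (intro closed_Collect_le) auto
      then have "compact (closure \<Omega> \<inter> {x. \<rho> x \<le> - \<delta>})"
        using bounded_\<Omega> by (intro compact_Int_closed) (auto simp: compact_closure)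
      then show "compact {x \<in> closure \<Omega>. \<rho> x \<le> - \<delta>}" by (simp add: Int_def)
      show "{x \<in> closure \<Omega>. \<rho> x \<le> - \<delta>} \<subseteq> \<Omega>"
        using that unfolding \<Omega>_eq by auto
    qed
    have IG: "integrable lborel (\<lambda>x. indicator \<Omega> x * G n x) \<and> (\<integral>x. indicator \<Omega> x * G n x \<partial>lborel) = 0" for n
    proof -
      define F where "F x = (\<eta> x * \<theta> n x) *\<^sub>R grad u x" for x
      define D where "D x v = (\<eta>' x * (grad \<rho> x \<bullet> v) * \<theta> n x + \<eta> x * (\<kappa> n x * (grad u x \<bullet> v))) *\<^sub>R grad u x
        + (\<eta> x * \<theta> n x) *\<^sub>R hess u x v" for x v
      have dF: "(F has_derivative D x) (at x)" if x: "x \<in> \<Omega>" for x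
      proof -
        have 1: "(\<eta> has_derivative (\<lambda>v. \<eta>' x * (grad \<rho> x \<bullet> v))) (at x)"
        proof -
          have "((\<lambda>x. - \<rho> x - \<delta>) has_derivative (\<lambda>v. - (grad \<rho> x \<bullet> v))) (at x)"
            by (auto intro!: derivative_eq_intros d\<rho>)
          then have "((\<lambda>x. sqpos (- \<rho> x - \<delta>)) has_derivative (\<lambda>v. - (grad \<rho> x \<bullet> v) * (2 * max 0 (- \<rho> x - \<delta>)))) (at x)"
            by (rule has_derivative_compose[where f="\<lambda>x. - \<rho> x - \<delta>", THEN has_derivative_eq_rhs])
              (use DERIV_sqpos in \<open>auto simp: has_field_derivative_def fun_eq_iff mult.commute\<close>)
          then show ?thesis
            unfolding \<eta>_def[abs_def] \<eta>'_def by (rule has_derivative_eq_rhs) (auto simp: fun_eq_iff algebra_simps)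
        qed
        have 2: "(\<theta> n has_derivative (\<lambda>v. \<kappa> n x * (grad u x \<bullet> v))) (at x)"
        proof -
          have "((\<lambda>s. arctan (c * s) / c) has_real_derivative 1 / (1 + (c * s)\<^sup>2)) (at s)" if "c > 0" for c s :: real
            using that by (auto intro!: derivative_eq_intros simp: inverse_eq_divide)
          then have "((\<lambda>s. arctan (real (Suc n) * s) / real (Suc n)) has_real_derivative \<kappa> n x) (at (u x))"
            unfolding \<kappa>_def by simp
          then have "((\<lambda>x. arctan (real (Suc n) * u x) / real (Suc n)) has_derivative (\<lambda>v. (grad u x \<bullet> v) * \<kappa> n x)) (at x)"
            by (intro has_derivative_compose[OF has_derivative_u[OF x], THEN has_derivative_eq_rhs])
              (auto simp: has_field_derivative_def fun_eq_iff mult.commute)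
          then show ?thesis
            unfolding \<theta>_def[abs_def] by (simp add: mult.commute)
        qed
        show ?thesis
          unfolding F_def D_def
          by (rule derivative_eq_intros 1 2 has_derivative_grad_u[OF x] refl)+
            (auto simp: fun_eq_iff algebra_simps)
      qed
      have tr: "lin_trace (D x) = G n x" if x: "x \<in> \<Omega>" for x
      proof -
        have "linear (\<lambda>v. \<eta>' x * (grad \<rho> x \<bullet> v) * \<theta> n x + \<eta> x * (\<kappa> n x * (grad u x \<bullet> v)))"
          by (auto intro!: linearI simp: algebra_simps inner_add_right)
        then show ?thesis
          unfolding D_def G_def
          by (simp add: lin_trace_add lin_trace_scaleR lin_trace_rank_one power2_norm_eq_inner)
      qed
      have b\<theta>n: "bounded (\<theta> n ` \<Omega>)" and b\<kappa>n: "bounded (\<kappa> n ` \<Omega>)"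
        using bounded_fst_slice[OF b\<theta>] bounded_fst_slice[OF b\<kappa>] .
      have bD: "bounded ((\<lambda>x. D x b \<bullet> b) ` \<Omega>)" if "b \<in> Basis" for b
        unfolding D_def
        by (intro bounded_inner_comp bounded_plus_comp bounded_scaleR_comp2 bounded_mult_comp
            bounded_const_comp b\<theta>n b\<kappa>n b\<eta> b\<rho> bounded_grad bounded_hess[OF that])
      have F0: "F x = 0" if "x \<in> \<Omega>" "x \<notin> {x \<in> closure \<Omega>. \<rho> x \<le> - \<delta>}" for x
        using that closure_subset[of \<Omega>] by (auto simp: F_def \<eta>_def sqpos_def)
      have eq: "indicator \<Omega> x * lin_trace (D x) = indicator \<Omega> x * G n x" for x
        using tr[of x] by (cases "x \<in> \<Omega>") auto
      show ?thesis
        using integral_divergence_eq_0[OF open_\<Omega> bounded_\<Omega> K dF bD F0] unfolding eq by blast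
    qed
    have lim: "(\<lambda>n. indicator \<Omega> x * G n x) \<longlonglongrightarrow> L x" for x
    proof -
      have "(\<lambda>n. 2 / real (Suc n)) \<longlonglongrightarrow> 0" using LIMSEQ_Suc[OF lim_const_over_n] .
      then have \<theta>: "(\<lambda>n. \<theta> n x) \<longlonglongrightarrow> 0"
        by (rule Lim_null_comparison[rotated]) (use \<theta>_le in auto)
      have \<kappa>: "(\<lambda>n. \<kappa> n x) \<longlonglongrightarrow> (if u x = 0 then 1 else 0)"
      proof (cases "u x = 0")
        case False
        have "filterlim (\<lambda>n. real (Suc n) * \<bar>u x\<bar>) at_top sequentially"
          using False by (intro filterlim_at_top_mult_tendsto_pos[OF tendsto_const] filterlim_compose[OF filterlim_real_sequentially filterlim_Suc]) auto
        then have "filterlim (\<lambda>n. (real (Suc n) * \<bar>u x\<bar>)\<^sup>2) at_top sequentially"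
          by (rule filterlim_pow_at_top[rotated]) simp
        then have "filterlim (\<lambda>n. 1 + (real (Suc n) * u x)\<^sup>2) at_top sequentially"
          by (intro filterlim_tendsto_add_at_top[OF tendsto_const]) (simp add: power_mult_distrib)
        then show ?thesis
          unfolding \<kappa>_def using False by (simp add: tendsto_divide_0[OF tendsto_const] filterlim_at_top_imp_at_infinity)
      qed (simp add: \<kappa>_def)
      have "(\<lambda>n. indicator \<Omega> x * G n x) \<longlonglongrightarrow> indicator \<Omega> x * (\<eta>' x * 0 * (grad \<rho> x \<bullet> grad u x)
        + \<eta> x * (if u x = 0 then 1 else 0) * (norm (grad u x))\<^sup>2 + \<eta> x * 0 * lin_trace (hess u x))"
        unfolding G_def by (intro tendsto_intros \<theta> \<kappa>)
      then show ?thesis by (simp only: L_def mult_zero_right mult_zero_left add_0_left add_0_right)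
    qed
    have bd: "AE x in lborel. norm (indicator \<Omega> x * G n x) \<le> \<bar>C\<bar> * indicator \<Omega> x" for n
    proof (rule AE_I2)
      fix x show "norm (indicator \<Omega> x * G n x) \<le> \<bar>C\<bar> * indicator \<Omega> x"
        using C[of x n] by (auto simp: indicator_def)
    qed
    have m: "(\<lambda>x. indicator \<Omega> x * G n x) \<in> borel_measurable lborel" for n
      using IG by blast
    have mL: "L \<in> borel_measurable lborel"
      by (rule borel_measurable_LIMSEQ_real[OF lim m])
    note dct = mL m integrable_const_indicator _ bd
    have iL: "integrable lborel L"
      by (rule integrable_dominated_convergence[where s="\<lambda>n x. indicator \<Omega> x * G n x", OF dct]) (simp add: lim)
    have "(\<lambda>n. \<integral>x. indicator \<Omega> x * G n x \<partial>lborel) \<longlonglongrightarrow> integral\<^sup>L lborel L"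
      by (rule integral_dominated_convergence[where s="\<lambda>n x. indicator \<Omega> x * G n x", OF dct]) (simp add: lim)
    then have "integral\<^sup>L lborel L = 0"
      using IG by (simp add: LIMSEQ_const_iff)
    \<comment> \<open>A nonnegative limit with integral 0 vanishes almost everywhere, and \<eta> is
      positive where \<open>\<rho> x < - \<delta>\<close>.\<close>
    moreover have "AE x in lborel. 0 \<le> L x"
      by (auto simp: L_def \<eta>_def sqpos_def)
    ultimately have "AE x in lborel. L x = 0"
      using integral_nonneg_eq_0_iff_AE[OF iL] by simp
    then show ?thesis
      by eventually_elim (auto simp: L_def \<eta>_def sqpos_def max_def split: if_splits)
  qed
  have "AE x in lborel. \<forall>n. x \<in> \<Omega> \<and> \<rho> x < - (1 / real (Suc n)) \<and> u x = 0 \<longrightarrow> grad u x = 0"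
    unfolding AE_all_countable using AE_\<delta> by simp
  then show ?thesis
  proof eventually_elim
    fix x assume *: "\<forall>n. x \<in> \<Omega> \<and> \<rho> x < - (1 / real (Suc n)) \<and> u x = 0 \<longrightarrow> grad u x = 0"
    show "x \<in> \<Omega> \<and> u x = 0 \<longrightarrow> grad u x = 0"
    proof
      assume x: "x \<in> \<Omega> \<and> u x = 0"
      then have "0 < - \<rho> x" by (simp add: \<Omega>_eq)
      then obtain n where "1 / real (Suc n) < - \<rho> x" using nat_approx_posE by blast
      then show "grad u x = 0" using * x by (metis minus_less_iff minus_minus)
    qed
  qed
qed

end

subsection \<open>The integral identity\<close>

text \<open>The component of the gradient along a drops out because \<open>norm a * (a \<bullet> z)
  = (a \<bullet> sgn a) * (z \<bullet> a)\<close>.\<close>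

lemma flux_div_scale:
  "flux_div (norm a) (sgn a) a A (\<eta> * w) (c *\<^sub>R a + \<eta> *\<^sub>R h) z
    = \<eta> * flux_div (norm a) (sgn a) a A w h z"
proof (cases "a = 0")
  case False
  have "a \<bullet> sgn a = norm a" using False by (simp add: sgn_div_norm dot_square_norm power2_eq_square)
  then show ?thesis
    unfolding flux_div_def by (simp add: algebra_simps inner_add_left inner_commute)
qed (simp add: flux_div_eq_0)

context level_sets
begin

text \<open>For \<open>X = \<psi>^2 (x - y)\<close> this is |grad u| times the tangential divergence
  of X minus |grad u| H (X . \<nu>): the divergence of |grad u| times the tangential part of
  X.\<close>

definition curv_flux :: "('a \<Rightarrow> real) \<Rightarrow> 'a \<Rightarrow> 'a \<Rightarrow> real" where
  "curv_flux \<psi> y x = norm (grad u x) * ((real DIM('a) - 1) * (\<psi> x)\<^sup>2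
     + 2 * \<psi> x * (tan_grad u \<psi> x \<bullet> (x - y))
     - (\<psi> x)\<^sup>2 * mean_curv u x * (unit_normal u x \<bullet> (x - y)))"

lemma flux_div_curv_flux:
  assumes "x \<in> \<Omega>"
  shows "flux_div (norm (grad u x)) (sgn (grad u x)) (grad u x) (hess u x) ((\<psi> x)\<^sup>2) ((2 * \<psi> x) *\<^sub>R grad \<psi> x) (x - y)
    = curv_flux \<psi> y x"
  using flux_div_mean_curv[OF open_U smooth] \<Omega>_subset assms unfolding curv_flux_def by blast

lemma measurable_restrict:
  fixes f :: "'a \<Rightarrow> 'b::{second_countable_topology, real_normed_vector}"
  assumes "continuous_on V f" "\<Omega> \<subseteq> V"
  shows "(\<lambda>x. indicator \<Omega> x *\<^sub>R f x) \<in> borel_measurable borel"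
  using borel_measurable_continuous_on_indicator[OF measurable_\<Omega>] continuous_on_subset[OF assms] by blast

lemma measurable_grad: "(\<lambda>x. indicator \<Omega> x *\<^sub>R grad u x) \<in> borel_measurable borel"
  using measurable_restrict[OF continuous_on_grad[OF smooth] \<Omega>_subset] .

text \<open>Serves measurability of H. Off the critical points H is an explicit expression in the
  gradient and the Hessian; the second derivative along \<nu> is expanded in the basis because
  continuity is known for the columns of the Hessian.\<close>

lemma continuous_on_mean_curv: "continuous_on {x \<in> \<Omega>. grad u x \<noteq> 0} (mean_curv u)"
proof -
  let ?S = "{x \<in> \<Omega>. grad u x \<noteq> 0}"
  have S: "?S \<subseteq> U" using \<Omega>_subset by auto
  have cg: "continuous_on ?S (grad u)" by (rule continuous_on_subset[OF continuous_on_grad[OF smooth] S])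
  have ch: "continuous_on ?S (\<lambda>x. hess u x b)" if "b \<in> Basis" for b
    by (rule continuous_on_subset[OF continuous_on_hess[OF smooth that] S])
  have cn: "continuous_on ?S (unit_normal u)"
    unfolding unit_normal_def[abs_def] by (intro continuous_intros cg) auto
  have "continuous_on ?S (\<lambda>x. (lin_trace (hess u x)
      - (\<Sum>b\<in>Basis. (unit_normal u x \<bullet> b) * (unit_normal u x \<bullet> hess u x b))) / norm (grad u x))"
    unfolding lin_trace_def by (intro continuous_intros cg ch cn) auto
  moreover have "mean_curv u x = (lin_trace (hess u x)
      - (\<Sum>b\<in>Basis. (unit_normal u x \<bullet> b) * (unit_normal u x \<bullet> hess u x b))) / norm (grad u x)"
    if x: "x \<in> ?S" for x
  proof -
    have "hess u x (unit_normal u x) = hess u x (\<Sum>b\<in>Basis. (unit_normal u x \<bullet> b) *\<^sub>R b)"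
      by (simp add: euclidean_representation)
    also have "\<dots> = (\<Sum>b\<in>Basis. (unit_normal u x \<bullet> b) *\<^sub>R hess u x b)"
      using linear_hess x by (simp add: linear_sum linear_cmul)
    finally have "unit_normal u x \<bullet> hess u x (unit_normal u x)
      = (\<Sum>b\<in>Basis. (unit_normal u x \<bullet> b) * (unit_normal u x \<bullet> hess u x b))"
      by (simp add: inner_sum_right)
    then show ?thesis
      using mean_curv_eq[OF open_U smooth, of x] x S by (auto simp: field_simps)
  qed
  ultimately show ?thesis by (metis (no_types, lifting) continuous_on_eq)
qed

lemma measurable_mean_curv:
  "(\<lambda>x. indicator {x \<in> \<Omega>. grad u x \<noteq> 0} x *\<^sub>R mean_curv u x) \<in> borel_measurable borel"
proof -
  have "open {x \<in> \<Omega>. grad u x \<noteq> 0}"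
  proof -
    have "continuous_on \<Omega> (grad u)"
      by (rule continuous_on_subset[OF continuous_on_grad[OF smooth] \<Omega>_subset])
    then have "open (\<Omega> \<inter> grad u -` (- {0}))"
      using continuous_open_preimage open_\<Omega> by blast
    then show ?thesis by (simp add: vimage_def Int_def)
  qed
  then show ?thesis
    by (intro borel_measurable_continuous_on_indicator continuous_on_mean_curv) simp
qed

context
  fixes V :: "'a set" and \<psi> :: "'a \<Rightarrow> real" and y :: 'a
  assumes V: "open V" "closure \<Omega> \<subseteq> V" and \<psi>: "C1_on V \<psi>"
begin

lemma \<Omega>_subset_V: "\<Omega> \<subseteq> V"
  using V closure_subset by blast

lemma continuous_on_C1: "continuous_on V \<psi>" "continuous_on V (grad \<psi>)"
  using \<psi> by (auto simp: C1_on_def intro: differentiable_imp_continuous_on)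

lemma bounded_C1: "bounded (\<psi> ` \<Omega>)" "bounded (grad \<psi> ` \<Omega>)"
  using bounded_image continuous_on_C1 V(2) by blast+

lemma has_derivative_C1: "x \<in> \<Omega> \<Longrightarrow> (\<psi> has_derivative (\<lambda>v. grad \<psi> x \<bullet> v)) (at x)"
  using \<psi> V \<Omega>_subset_V unfolding C1_on_def
  by (intro has_derivative_grad) (auto simp: differentiable_on_eq_differentiable_at)

lemma measurable_C1:
  "(\<lambda>x. indicator \<Omega> x *\<^sub>R \<psi> x) \<in> borel_measurable borel"
  "(\<lambda>x. indicator \<Omega> x *\<^sub>R grad \<psi> x) \<in> borel_measurable borel"
  using measurable_restrict[OF _ \<Omega>_subset_V] continuous_on_C1 by blast+

lemma measurable_curv_flux: "(\<lambda>x. indicator \<Omega> x * curv_flux \<psi> y x) \<in> borel_measurable borel"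
proof -
  \<comment> \<open>Each ingredient is first cut off to the set where its regularity is known; the
    factor \<open>norm (a x)\<close> vanishes wherever this changes a value.\<close>
  define a where "a x = indicator \<Omega> x *\<^sub>R grad u x" for x
  define h where "h x = indicator {x \<in> \<Omega>. grad u x \<noteq> 0} x *\<^sub>R mean_curv u x" for x
  define f where "f x = indicator \<Omega> x *\<^sub>R \<psi> x" for x
  define g where "g x = indicator \<Omega> x *\<^sub>R grad \<psi> x" for x
  have [measurable]: "a \<in> borel_measurable borel" "h \<in> borel_measurable borel"
    "f \<in> borel_measurable borel" "g \<in> borel_measurable borel"
    unfolding a_def[abs_def] h_def[abs_def] f_def[abs_def] g_def[abs_def]
    using measurable_grad measurable_mean_curv measurable_C1 by auto
  define \<nu> where "\<nu> x = (1 / norm (a x)) *\<^sub>R a x" for x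
  have [measurable]: "\<nu> \<in> borel_measurable borel"
    unfolding \<nu>_def[abs_def] by measurable
  have "indicator \<Omega> x * curv_flux \<psi> y x = norm (a x) * ((real DIM('a) - 1) * (f x)\<^sup>2
     + 2 * f x * ((g x - (g x \<bullet> \<nu> x) *\<^sub>R \<nu> x) \<bullet> (x - y)) - (f x)\<^sup>2 * h x * (\<nu> x \<bullet> (x - y)))" for x
    by (cases "x \<in> \<Omega>"; cases "grad u x = 0")
      (auto simp: curv_flux_def a_def h_def f_def g_def \<nu>_def tan_grad_def unit_normal_def)
  moreover have "(\<lambda>x. norm (a x) * ((real DIM('a) - 1) * (f x)\<^sup>2
     + 2 * f x * ((g x - (g x \<bullet> \<nu> x) *\<^sub>R \<nu> x) \<bullet> (x - y)) - (f x)\<^sup>2 * h x * (\<nu> x \<bullet> (x - y)))) \<in> borel_measurable borel"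
    by measurable
  ultimately show ?thesis by simp
qed

lemma bounded_diff_const: "bounded ((\<lambda>x. x - y) ` \<Omega>)"
  using bounded_\<Omega> by (intro bounded_minus_comp bounded_const_comp) simp

lemma bounded_sgn_grad: "bounded ((\<lambda>x. sgn (grad u x)) ` \<Omega>)"
  unfolding bounded_iff by (intro exI[of _ 1]) (auto simp: norm_sgn)

lemma bounded_norm_grad: "bounded ((\<lambda>x. norm (grad u x)) ` \<Omega>)"
  using bounded_grad by (simp add: bounded_norm_comp)

text \<open>H alone may blow up at critical points, so the bound is taken from the
  \<open>flux_div\<close> form, in which H occurs only multiplied by |grad u|.\<close>

lemma bounded_curv_flux: "bounded ((\<lambda>x. curv_flux \<psi> y x) ` \<Omega>)"
proof -
  have "bounded ((\<lambda>x. flux_div (norm (grad u x)) (sgn (grad u x)) (grad u x) (hess u x) ((\<psi> x)\<^sup>2)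
      ((2 * \<psi> x) *\<^sub>R grad \<psi> x) (x - y)) ` \<Omega>)"
    unfolding power2_eq_square
    by (intro bounded_flux_div linear_hess bounded_hess bounded_sgn_grad bounded_norm_grad bounded_grad
        bounded_mult_comp bounded_scaleR_comp2 bounded_const_comp bounded_C1 bounded_diff_const)
  then show ?thesis
    by (simp add: flux_div_curv_flux cong: image_cong)
qed

lemma compact_superlevel:
  assumes "continuous_on W f" "closure \<Omega> \<subseteq> W" "\<And>x. x \<in> frontier \<Omega> \<Longrightarrow> f x = 0" "0 < e"
  shows "compact {x \<in> closure \<Omega>. e \<le> \<bar>f x :: real\<bar>}" "{x \<in> closure \<Omega>. e \<le> \<bar>f x\<bar>} \<subseteq> \<Omega>"
proof -
  have c: "compact (closure \<Omega>)" using bounded_\<Omega> by (simp add: compact_closure)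
  have "continuous_on (closure \<Omega>) (\<lambda>x. \<bar>f x\<bar>)"
    using continuous_on_subset[OF assms(1,2)] by (intro continuous_intros)
  then have "closed (closure \<Omega> \<inter> (\<lambda>x. \<bar>f x\<bar>) -` {e..})"
    by (intro continuous_closed_preimage) auto
  then have "compact (closure \<Omega> \<inter> (closure \<Omega> \<inter> (\<lambda>x. \<bar>f x\<bar>) -` {e..}))"
    using c by (intro compact_Int_closed)
  then show "compact {x \<in> closure \<Omega>. e \<le> \<bar>f x\<bar>}" by (simp add: vimage_def Int_def)
  show "{x \<in> closure \<Omega>. e \<le> \<bar>f x\<bar>} \<subseteq> \<Omega>"
    using assms(3,4) open_\<Omega> by (force simp: frontier_def interior_open)
qed

text \<open>Truncating the square of \<psi> itself avoids a boundary layer: the gradient of the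
  truncation is at most \<open>2 \<bar>\<psi>\<bar>\<close> times that of \<psi>, uniformly in n,
  and converges to the gradient of the square.\<close>

lemma integral_curv_flux_eq_0_vanishing:
  assumes bc: "\<And>x. x \<in> frontier \<Omega> \<Longrightarrow> \<psi> x = 0"
  shows "(\<integral>x. indicator \<Omega> x * curv_flux \<psi> y x \<partial>lborel) = 0"
proof -
  define e where "e n = 1 / real (Suc n)" for n
  have e: "0 < e n" for n by (simp add: e_def)
  have e0: "e \<longlonglongrightarrow> 0" unfolding e_def by (rule LIMSEQ_Suc[OF lim_1_over_n])
  define \<omega> where "\<omega> n x = trunc_sq (e n) (\<psi> x)" for n x
  define g where "g n x = trunc_sq' (e n) (\<psi> x) *\<^sub>R grad \<psi> x" for n x
  define G where "G n x = flux_div (norm (grad u x)) (sgn (grad u x)) (grad u x) (hess u x) (\<omega> n x) (g n x) (x - y)" for n x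
  obtain M where M: "\<And>x. x \<in> \<Omega> \<Longrightarrow> \<bar>\<psi> x\<bar> \<le> M" using bounded_C1(1) by (auto simp: bounded_iff)
  have b\<omega>: "bounded ((\<lambda>q. \<omega> (fst q) (snd q)) ` (UNIV \<times> \<Omega>))"
    unfolding bounded_iff
  proof (intro exI[of _ "M\<^sup>2"] ballI, clarsimp)
    fix n x assume x: "x \<in> \<Omega>"
    have "\<bar>\<omega> n x\<bar> \<le> (\<psi> x)\<^sup>2"
      using trunc_sq_nonneg[of "e n" "\<psi> x"] trunc_sq_le[of "e n" "\<psi> x"] e[of n] by (simp add: \<omega>_def)
    also have "\<dots> \<le> M\<^sup>2" using M[OF x] by (metis abs_ge_zero power2_abs power_mono)
    finally show "\<bar>\<omega> n x\<bar> \<le> M\<^sup>2" .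
  qed
  have bt: "bounded ((\<lambda>q. trunc_sq' (e (fst q)) (\<psi> (snd q))) ` (UNIV \<times> \<Omega>))"
    unfolding bounded_iff
  proof (intro exI[of _ "2 * M"] ballI, clarsimp)
    fix n x assume x: "x \<in> \<Omega>"
    show "\<bar>trunc_sq' (e n) (\<psi> x)\<bar> \<le> 2 * M"
      using trunc_sq'_le[of "e n" "\<psi> x"] e[of n] M[OF x] by simp
  qed
  have bg: "bounded ((\<lambda>q. g (fst q) (snd q)) ` (UNIV \<times> \<Omega>))"
    unfolding g_def by (intro bounded_scaleR_comp2 bt bounded_snd_comp[OF bounded_C1(2)])
  have "bounded ((\<lambda>q. G (fst q) (snd q)) ` (UNIV \<times> \<Omega>))"
    unfolding G_def
    by (rule bounded_flux_div[where A="\<lambda>q. hess u (snd q)", OF _ bounded_snd_comp[OF bounded_hess]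
          bounded_snd_comp[OF bounded_norm_grad] bounded_snd_comp[OF bounded_sgn_grad] bounded_snd_comp[OF bounded_grad]
          b\<omega> bg bounded_snd_comp[OF bounded_diff_const]])
      (auto intro: linear_hess)
  then obtain C where C: "\<And>n x. x \<in> \<Omega> \<Longrightarrow> \<bar>G n x\<bar> \<le> C"
    unfolding bounded_iff by fastforce
  have IG: "integrable lborel (\<lambda>x. indicator \<Omega> x * G n x) \<and> (\<integral>x. indicator \<Omega> x * G n x \<partial>lborel) = 0" for n
  proof -
    have d\<omega>: "(\<omega> n has_derivative (\<lambda>v. g n x \<bullet> v)) (at x)" if x: "x \<in> \<Omega>" for x
    proof -
      have "((\<lambda>x. trunc_sq (e n) (\<psi> x)) has_derivative (\<lambda>v. (grad \<psi> x \<bullet> v) * trunc_sq' (e n) (\<psi> x))) (at x)"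
        by (rule has_derivative_compose[OF has_derivative_C1[OF x], THEN has_derivative_eq_rhs])
          (use DERIV_trunc_sq in \<open>auto simp: has_field_derivative_def fun_eq_iff mult.commute\<close>)
      then show ?thesis unfolding \<omega>_def[abs_def] g_def by (simp add: mult.commute)
    qed
    have z: "\<omega> n x = 0" if "x \<in> \<Omega>" "x \<notin> {x \<in> closure \<Omega>. e n \<le> \<bar>\<psi> x\<bar>}" for x
      using that closure_subset[of \<Omega>] by (auto simp: \<omega>_def intro!: trunc_sq_eq_0)
    show ?thesis
      unfolding G_def
      using integral_flux_div_eq_0[where A="hess u", OF open_\<Omega> bounded_\<Omega> compact_superlevel[OF continuous_on_C1(1) V(2) bc e]
        has_derivative_grad_u hess_symmetric[OF open_U smooth] d\<omega> z bounded_grad bounded_hess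
        bounded_fst_slice[OF b\<omega>] bounded_fst_slice[OF bg]] \<Omega>_subset by blast
  qed
  have lim: "(\<lambda>n. indicator \<Omega> x * G n x) \<longlonglongrightarrow> indicator \<Omega> x * curv_flux \<psi> y x" for x
  proof (cases "x \<in> \<Omega>")
    case True
    show ?thesis
      unfolding flux_div_curv_flux[OF True, symmetric] G_def flux_div_def \<omega>_def g_def
      by (intro tendsto_intros tendsto_trunc_sq e0)
  qed simp
  have bd: "AE x in lborel. norm (indicator \<Omega> x * G n x) \<le> \<bar>C\<bar> * indicator \<Omega> x" for n
  proof (rule AE_I2)
    fix x show "norm (indicator \<Omega> x * G n x) \<le> \<bar>C\<bar> * indicator \<Omega> x"
      using C[of x n] by (auto simp: indicator_def)
  qed
  have m: "(\<lambda>x. indicator \<Omega> x * G n x) \<in> borel_measurable lborel" for n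
    using IG by blast
  have mL: "(\<lambda>x. indicator \<Omega> x * curv_flux \<psi> y x) \<in> borel_measurable lborel"
    using measurable_curv_flux by simp
  have "(\<lambda>n. \<integral>x. indicator \<Omega> x * G n x \<partial>lborel) \<longlonglongrightarrow> (\<integral>x. indicator \<Omega> x * curv_flux \<psi> y x \<partial>lborel)"
    by (rule integral_dominated_convergence[where s="\<lambda>n x. indicator \<Omega> x * G n x", OF mL m integrable_const_indicator _ bd])
      (simp add: lim)
  then show ?thesis
    using IG by (simp add: LIMSEQ_const_iff)
qed

text \<open>A cutoff depending on \<open>u\<close> only has no tangential derivative, so it merely multiplies the integrand.\<close>

lemma integral_curv_flux_eq_0_level:
  assumes bc: "\<And>x. x \<in> frontier \<Omega> \<Longrightarrow> u x = 0"
    and null: "AE x in lborel. x \<in> \<Omega> \<and> u x = 0 \<longrightarrow> grad u x = 0"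
  shows "(\<integral>x. indicator \<Omega> x * curv_flux \<psi> y x \<partial>lborel) = 0"
proof -
  define e where "e n = 1 / real (Suc n)" for n
  have e: "0 < e n" for n by (simp add: e_def)
  have e0: "e \<longlonglongrightarrow> 0" unfolding e_def by (rule LIMSEQ_Suc[OF lim_1_over_n])
  \<comment> \<open>\<open>\<eta> n\<close> takes values in [0, 1], vanishes for
    \<open>\<bar>t\<bar> \<le> e n\<close> and tends to 1 off 0. A bound on \<open>\<eta>' n\<close>
    for each fixed n is enough, since \<open>flux_div_scale\<close> eliminates the derivative before
    the limit.\<close>
  define \<eta> where "\<eta> n t = trunc_sq (e n) t / (trunc_sq (e n) t + e n)" for n t
  define \<eta>' where "\<eta>' n t = trunc_sq' (e n) t * e n * (1 / (trunc_sq (e n) t + e n)) * (1 / (trunc_sq (e n) t + e n))" for n t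
  have pos: "0 < trunc_sq (e n) t + e n" for n t
    using trunc_sq_nonneg[of "e n" t] e[of n] by linarith
  have \<eta>01: "0 \<le> \<eta> n t" "\<eta> n t \<le> 1" for n t
    using trunc_sq_nonneg[of "e n" t] e[of n] pos[of n t] by (auto simp: \<eta>_def)
  define \<omega> where "\<omega> n x = \<eta> n (u x) * (\<psi> x)\<^sup>2" for n x
  define g where "g n x = (\<eta>' n (u x) * (\<psi> x)\<^sup>2) *\<^sub>R grad u x + \<eta> n (u x) *\<^sub>R ((2 * \<psi> x) *\<^sub>R grad \<psi> x)" for n x
  obtain C where C: "\<And>x. x \<in> \<Omega> \<Longrightarrow> \<bar>curv_flux \<psi> y x\<bar> \<le> C"
    using bounded_curv_flux by (auto simp: bounded_iff)
  have IG: "integrable lborel (\<lambda>x. indicator \<Omega> x * (\<eta> n (u x) * curv_flux \<psi> y x))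
     \<and> (\<integral>x. indicator \<Omega> x * (\<eta> n (u x) * curv_flux \<psi> y x) \<partial>lborel) = 0" for n
  proof -
    have d\<eta>: "(\<eta> n has_real_derivative \<eta>' n t) (at t)" for t
      unfolding \<eta>_def[abs_def] \<eta>'_def
      using pos[of n t]
      by (auto intro!: derivative_eq_intros DERIV_trunc_sq simp: field_simps power2_eq_square)
    have d\<omega>: "(\<omega> n has_derivative (\<lambda>v. g n x \<bullet> v)) (at x)" if x: "x \<in> \<Omega>" for x
    proof -
      have 1: "((\<lambda>x. \<eta> n (u x)) has_derivative (\<lambda>v. (grad u x \<bullet> v) * \<eta>' n (u x))) (at x)"
        by (rule has_derivative_compose[OF has_derivative_u[OF x], THEN has_derivative_eq_rhs])
          (use d\<eta> in \<open>auto simp: has_field_derivative_def fun_eq_iff mult.commute\<close>)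
      show ?thesis
        unfolding \<omega>_def[abs_def] g_def
        by (rule derivative_eq_intros 1 has_derivative_C1[OF x] refl)+
          (auto simp: fun_eq_iff algebra_simps inner_add_left power2_eq_square)
    qed
    have z: "\<omega> n x = 0" if "x \<in> \<Omega>" "x \<notin> {x \<in> closure \<Omega>. e n \<le> \<bar>u x\<bar>}" for x
      using that closure_subset[of \<Omega>] by (auto simp: \<omega>_def \<eta>_def trunc_sq_eq_0)
    have b\<eta>: "bounded ((\<lambda>x. \<eta> n (u x)) ` \<Omega>)"
      unfolding bounded_iff using \<eta>01 by (intro exI[of _ 1]) auto
    have bt: "bounded ((\<lambda>x. trunc_sq' (e n) (u x)) ` \<Omega>)"
    proof -
      obtain M where M: "\<And>x. x \<in> \<Omega> \<Longrightarrow> \<bar>u x\<bar> \<le> M" using bounded_u by (auto simp: bounded_iff)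
      have "\<bar>trunc_sq' (e n) (u x)\<bar> \<le> 2 * M" if "x \<in> \<Omega>" for x
        using trunc_sq'_le[of "e n" "u x"] e[of n] M[OF that] by simp
      then show ?thesis unfolding bounded_iff by auto
    qed
    have bi: "bounded ((\<lambda>x. 1 / (trunc_sq (e n) (u x) + e n)) ` \<Omega>)"
      unfolding bounded_iff
    proof (intro exI[of _ "1 / e n"] ballI, clarsimp)
      fix x show "1 / \<bar>trunc_sq (e n) (u x) + e n\<bar> \<le> 1 / e n"
        using trunc_sq_nonneg[of "e n" "u x"] e[of n] by (intro frac_le) auto
    qed
    have b\<omega>: "bounded (\<omega> n ` \<Omega>)" and bg: "bounded (g n ` \<Omega>)"
      unfolding \<omega>_def[abs_def] g_def[abs_def] \<eta>'_def power2_eq_square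
      by (intro bounded_plus_comp bounded_scaleR_comp2 bounded_mult_comp bounded_const_comp
          b\<eta> bt bi bounded_grad bounded_C1)+
    have eq: "indicator \<Omega> x * flux_div (norm (grad u x)) (sgn (grad u x)) (grad u x) (hess u x) (\<omega> n x) (g n x) (x - y)
      = indicator \<Omega> x * (\<eta> n (u x) * curv_flux \<psi> y x)" for x
      unfolding \<omega>_def g_def flux_div_scale by (cases "x \<in> \<Omega>") (simp_all add: flux_div_curv_flux)
    show ?thesis
      unfolding eq[symmetric]
      using integral_flux_div_eq_0[where A="hess u", OF open_\<Omega> bounded_\<Omega> compact_superlevel[OF continuous_on_u closure_subset_U bc e]
        has_derivative_grad_u hess_symmetric[OF open_U smooth] d\<omega> z bounded_grad bounded_hess b\<omega> bg] \<Omega>_subset by blast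
  qed
  \<comment> \<open>As \<open>\<eta> n 0 = 0\<close> for all n, the limit misses the zero set of u;
    the assumption \<open>null\<close> restores it, because \<open>curv_flux\<close> contains the
    factor |grad u|.\<close>
  define L where "L x = indicator \<Omega> x * ((if u x = 0 then 0 else 1) * curv_flux \<psi> y x)" for x
  have lim: "(\<lambda>n. indicator \<Omega> x * (\<eta> n (u x) * curv_flux \<psi> y x)) \<longlonglongrightarrow> L x" for x
  proof -
    have "(\<lambda>n. \<eta> n (u x)) \<longlonglongrightarrow> (if u x = 0 then 0 else 1)"
    proof (cases "u x = 0")
      case True
      then show ?thesis using e by (simp add: \<eta>_def trunc_sq_eq_0 less_imp_le)
    next
      case False
      have "(\<lambda>n. \<eta> n (u x)) \<longlonglongrightarrow> (u x)\<^sup>2 / ((u x)\<^sup>2 + 0)"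
        unfolding \<eta>_def using False by (intro tendsto_intros tendsto_trunc_sq e0) auto
      then show ?thesis using False by simp
    qed
    then show ?thesis unfolding L_def by (intro tendsto_intros)
  qed
  have bd: "AE x in lborel. norm (indicator \<Omega> x * (\<eta> n (u x) * curv_flux \<psi> y x)) \<le> \<bar>C\<bar> * indicator \<Omega> x" for n
  proof (rule AE_I2)
    fix x
    have "\<bar>\<eta> n (u x) * curv_flux \<psi> y x\<bar> \<le> 1 * \<bar>curv_flux \<psi> y x\<bar>"
      unfolding abs_mult using \<eta>01[of n "u x"] by (intro mult_right_mono) auto
    then show "norm (indicator \<Omega> x * (\<eta> n (u x) * curv_flux \<psi> y x)) \<le> \<bar>C\<bar> * indicator \<Omega> x"
      using C[of x] by (auto simp: indicator_def)
  qed
  have m: "(\<lambda>x. indicator \<Omega> x * (\<eta> n (u x) * curv_flux \<psi> y x)) \<in> borel_measurable lborel" for n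
    using IG by blast
  have mL: "L \<in> borel_measurable lborel"
    by (rule borel_measurable_LIMSEQ_real[OF lim m])
  have "(\<lambda>n. \<integral>x. indicator \<Omega> x * (\<eta> n (u x) * curv_flux \<psi> y x) \<partial>lborel) \<longlonglongrightarrow> integral\<^sup>L lborel L"
    by (rule integral_dominated_convergence[where s="\<lambda>n x. indicator \<Omega> x * (\<eta> n (u x) * curv_flux \<psi> y x)",
          OF mL m integrable_const_indicator _ bd]) (simp add: lim)
  then have "integral\<^sup>L lborel L = 0"
    using IG by (simp add: LIMSEQ_const_iff)
  moreover have "integral\<^sup>L lborel L = (\<integral>x. indicator \<Omega> x * curv_flux \<psi> y x \<partial>lborel)"
  proof (rule integral_cong_AE)
    show "AE x in lborel. L x = indicator \<Omega> x * curv_flux \<psi> y x"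
      using null by eventually_elim (auto simp: L_def curv_flux_def indicator_def)
  qed (use mL measurable_curv_flux in auto)
  ultimately show ?thesis by simp
qed

lemma integrable_curv_flux: "integrable lborel (\<lambda>x. indicator \<Omega> x * curv_flux \<psi> y x)"
proof -
  obtain C where C: "\<And>x. x \<in> \<Omega> \<Longrightarrow> \<bar>curv_flux \<psi> y x\<bar> \<le> C"
    using bounded_curv_flux by (auto simp: bounded_iff)
  show ?thesis
  proof (rule Bochner_Integration.integrable_bound[OF integrable_const_indicator[of C]])
    show "AE x in lborel. norm (indicator \<Omega> x * curv_flux \<psi> y x) \<le> norm (C * indicator \<Omega> x)"
      by (rule AE_I2) (use C in \<open>force simp: indicator_def\<close>)
  qed (use measurable_curv_flux in simp)
qed

end

end

subsection \<open>The weighted inequality\<close>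

lemma le_ennsqrt_mult:
  assumes "Z\<^sup>2 \<le> X * B" "X \<noteq> \<infinity>"
  shows "Z \<le> ennsqrt X * ennsqrt B"
proof (cases "B = \<infinity>")
  case True
  show ?thesis
  \<comment> \<open>Here the product on the right is 0 times infinity, which is 0, so Z must be
    shown to vanish.\<close>
  proof (cases "X = 0")
    case True
    then show ?thesis using assms by (simp add: power_eq_0_iff)
  next
    case False
    then have "enn2real X > 0" using assms(2) by (simp add: enn2real_positive_iff less_top zero_less_iff_neq_zero)
    then show ?thesis using assms(2) \<open>B = \<infinity>\<close> by (simp add: ennsqrt_def ennreal_mult_top)
  qed
next
  case False
  obtain x where x: "X = ennreal x" "x \<ge> 0" using assms(2) by (cases X) auto
  obtain b where b: "B = ennreal b" "b \<ge> 0" using False by (cases B) auto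
  have "Z\<^sup>2 \<noteq> \<infinity>" using assms(1) by (auto simp: x b ennreal_mult[symmetric] top_unique)
  then have "Z \<noteq> \<infinity>" by auto
  then obtain z where z: "Z = ennreal z" "z \<ge> 0" by (cases Z) auto
  have "z\<^sup>2 \<le> x * b"
    using assms(1) x b z by (simp add: ennreal_power ennreal_mult[symmetric])
  then have "z \<le> sqrt x * sqrt b"
    by (simp add: real_le_rsqrt real_sqrt_mult[symmetric])
  then show ?thesis
    using x b z by (simp add: ennsqrt_def ennreal_mult[symmetric])
qed

text \<open>One factor \<open>ennsqrt X\<close> is cancelled, which is legitimate only for finite X:
  with X infinite the first assumption says nothing about a positive B. For \<open>X = 0\<close> the
  conclusion is trivial.\<close>

lemma mult_le_of_le_ennsqrt:
  assumes "ennreal m * X \<le> ennsqrt X * ennsqrt B" "X \<noteq> \<infinity>" "0 \<le> m"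
  shows "ennreal (m\<^sup>2) * X \<le> B"
proof (cases "B = \<infinity>")
  case False
  obtain x where x: "X = ennreal x" "x \<ge> 0" using assms(2) by (cases X) auto
  obtain b where b: "B = ennreal b" "b \<ge> 0" using False by (cases B) auto
  have "m * x \<le> sqrt x * sqrt b"
    using assms(1,3) x b by (simp add: ennsqrt_def ennreal_mult[symmetric])
  then have "(m * x)\<^sup>2 \<le> (sqrt x * sqrt b)\<^sup>2"
    using assms(3) x by (intro power_mono) auto
  then have "x * (m\<^sup>2 * x) \<le> x * b"
    using x b by (simp add: power_mult_distrib algebra_simps power2_eq_square)
  then have "m\<^sup>2 * x \<le> b"
    using x b by (cases "x = 0") auto
  then show ?thesis
    using x b by (simp add: ennreal_mult[symmetric])
qed simp

lemma ennsqrt_mono: "X \<le> Y \<Longrightarrow> ennsqrt X \<le> ennsqrt Y"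
  by (auto simp: ennsqrt_def top_unique intro!: ennreal_leI real_sqrt_le_mono enn2real_mono simp: less_top)

lemma Cauchy_Schwarz_pair:
  fixes a b c d :: real
  shows "a * b + c * d \<le> sqrt (a\<^sup>2 + c\<^sup>2) * sqrt (b\<^sup>2 + d\<^sup>2)"
proof -
  have "(a * b + c * d)\<^sup>2 \<le> (a\<^sup>2 + c\<^sup>2) * (b\<^sup>2 + d\<^sup>2)"
    using zero_le_power2[of "a * d - b * c"] by (simp add: power2_eq_square algebra_simps)
  then show ?thesis
    unfolding real_sqrt_mult[symmetric] by (rule real_le_rsqrt)
qed

text \<open>Write z as w plus q times \<nu> with w orthogonal to \<nu>. Cauchy-Schwarz in the plane
  pairs \<open>(2 * norm \<tau>, \<bar>h * f\<bar>)\<close> with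
  \<open>(norm w, \<bar>q\<bar>)\<close>, whose length is \<open>norm z\<close>.\<close>

lemma tangential_normal_le:
  fixes \<nu> \<tau> z :: "'a::real_inner" and f h :: real
  assumes \<nu>: "norm \<nu> = 1" and \<tau>: "\<tau> \<bullet> \<nu> = 0"
  shows "f\<^sup>2 * h * (\<nu> \<bullet> z) - 2 * f * (\<tau> \<bullet> z) \<le> \<bar>f\<bar> * norm z * sqrt (4 * (norm \<tau>)\<^sup>2 + h\<^sup>2 * f\<^sup>2)"
proof -
  define q where "q = \<nu> \<bullet> z"
  define w where "w = z - q *\<^sub>R \<nu>"
  have \<nu>1: "\<nu> \<bullet> \<nu> = 1" using \<nu> by (simp add: dot_square_norm)
  have "\<nu> \<bullet> w = 0" by (simp add: w_def inner_diff_right \<nu>1 q_def)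
  then have nz: "(norm z)\<^sup>2 = (norm w)\<^sup>2 + q\<^sup>2"
    unfolding power2_norm_eq_inner using \<nu>1
    by (simp add: w_def q_def algebra_simps inner_diff_left inner_commute power2_eq_square)
  have "\<tau> \<bullet> z = \<tau> \<bullet> w" using \<tau> by (simp add: w_def inner_diff_right)
  then have "\<bar>\<tau> \<bullet> z\<bar> \<le> norm \<tau> * norm w" using Cauchy_Schwarz_ineq2 by metis
  then have "\<bar>f\<bar> * \<bar>\<tau> \<bullet> z\<bar> \<le> \<bar>f\<bar> * (norm \<tau> * norm w)" by (intro mult_left_mono) auto
  then have "- (f * (\<tau> \<bullet> z)) \<le> \<bar>f\<bar> * (norm \<tau> * norm w)"
    by (simp add: abs_mult[symmetric])
  moreover have "f\<^sup>2 * h * q \<le> \<bar>f\<bar> * (\<bar>h * f\<bar> * \<bar>q\<bar>)"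
    by (simp add: abs_mult[symmetric] power2_eq_square mult.assoc)
      (metis abs_ge_self abs_mult mult.commute mult.left_commute)
  ultimately have "f\<^sup>2 * h * q - 2 * f * (\<tau> \<bullet> z) \<le> \<bar>f\<bar> * ((2 * norm \<tau>) * norm w + \<bar>h * f\<bar> * \<bar>q\<bar>)"
    by (simp add: algebra_simps)
  also have "\<dots> \<le> \<bar>f\<bar> * (sqrt ((2 * norm \<tau>)\<^sup>2 + \<bar>h * f\<bar>\<^sup>2) * sqrt ((norm w)\<^sup>2 + \<bar>q\<bar>\<^sup>2))"
    by (intro mult_left_mono Cauchy_Schwarz_pair) auto
  also have "\<dots> = \<bar>f\<bar> * norm z * sqrt (4 * (norm \<tau>)\<^sup>2 + h\<^sup>2 * f\<^sup>2)"
    by (simp add: nz[symmetric] power_mult_distrib)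
  finally show ?thesis by (simp add: q_def)
qed

text \<open>Differentiate \<open>u\<close> along a great circle about \<open>y\<close>: the profile \<open>g\<close> need not be differentiable.\<close>

lemma norm_grad_radial:
  fixes u :: "'a::euclidean_space \<Rightarrow> real"
  assumes "open \<Omega>" "x \<in> \<Omega>" "x \<noteq> y" and rad: "\<And>x. x \<in> \<Omega> \<Longrightarrow> u x = g (dist x y)"
    and du: "(u has_derivative (\<lambda>v. grad u x \<bullet> v)) (at x)"
  shows "norm (grad u x) = \<bar>rad_deriv u y x\<bar>"
proof -
  define z where "z = x - y"
  have z: "z \<noteq> 0" using assms(3) by (simp add: z_def)
  define \<tau> where "\<tau> = grad u x - ((grad u x \<bullet> z) / (z \<bullet> z)) *\<^sub>R z"
  have \<tau>z: "\<tau> \<bullet> z = 0" using z by (simp add: \<tau>_def inner_diff_left)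
  have "\<tau> = 0"
  proof (rule ccontr)
    assume "\<tau> \<noteq> 0"
    \<comment> \<open>v is tangential with the length of z, so that \<gamma> stays on the sphere
      through x; u is constant along \<gamma> as long as it remains in \<Omega>.\<close>
    define v where "v = (norm z / norm \<tau>) *\<^sub>R \<tau>"
    have v: "v \<bullet> z = 0" "norm v = norm z" using \<tau>z \<open>\<tau> \<noteq> 0\<close> by (auto simp: v_def)
    define \<gamma> where "\<gamma> t = y + cos t *\<^sub>R z + sin t *\<^sub>R v" for t
    have \<gamma>0: "\<gamma> 0 = x" by (simp add: \<gamma>_def z_def)
    have d: "dist (\<gamma> t) y = norm z" for t
    proof -
      have "(norm (cos t *\<^sub>R z + sin t *\<^sub>R v))\<^sup>2 = (cos t)\<^sup>2 * (norm z)\<^sup>2 + (sin t)\<^sup>2 * (norm v)\<^sup>2"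
        unfolding power2_norm_eq_inner using v(1)
        by (simp add: algebra_simps inner_add_left inner_commute power2_eq_square)
      also have "\<dots> = (norm z)\<^sup>2"
        unfolding v(2) by (metis distrib_right mult_1 sin_cos_squared_add2)
      finally show ?thesis by (simp add: dist_norm \<gamma>_def)
    qed
    have d\<gamma>: "(\<gamma> has_derivative (\<lambda>t. t *\<^sub>R v)) (at 0)"
      unfolding \<gamma>_def by (auto intro!: derivative_eq_intros)
    have "((\<lambda>t. u (\<gamma> t)) has_derivative (\<lambda>t. grad u x \<bullet> (t *\<^sub>R v))) (at 0)"
      by (rule has_derivative_compose[OF d\<gamma>]) (simp add: \<gamma>0 du)
    moreover have "((\<lambda>t. u (\<gamma> t)) has_derivative (\<lambda>t. 0)) (at 0)"
    proof (rule has_derivative_transform_within_open[of "\<lambda>_. g (norm z)" _ _ _ "\<gamma> -` \<Omega>"])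
      have "continuous_on UNIV \<gamma>" unfolding \<gamma>_def by (intro continuous_intros)
      then show "open (\<gamma> -` \<Omega>)" using \<open>open \<Omega>\<close> by (simp add: open_vimage)
      show "0 \<in> \<gamma> -` \<Omega>" using \<gamma>0 assms(2) by simp
      show "g (norm z) = u (\<gamma> t)" if "t \<in> \<gamma> -` \<Omega>" for t
        using rad[of "\<gamma> t"] that by (simp add: d)
    qed simp
    ultimately have "(\<lambda>t::real. grad u x \<bullet> (t *\<^sub>R v)) = (\<lambda>t. 0)"
      by (rule has_derivative_unique)
    then have "grad u x \<bullet> (1 *\<^sub>R v) = 0" by meson
    then have "grad u x \<bullet> \<tau> = 0" using z \<open>\<tau> \<noteq> 0\<close> by (simp add: v_def)
    moreover have "\<tau> \<bullet> \<tau> = grad u x \<bullet> \<tau>"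
      using \<tau>z by (subst (1) \<tau>_def) (simp add: inner_diff_left inner_diff_right inner_commute)
    ultimately show False using \<open>\<tau> \<noteq> 0\<close> by simp
  qed
  then have g: "grad u x = ((grad u x \<bullet> z) / (z \<bullet> z)) *\<^sub>R z" by (simp add: \<tau>_def)
  have "norm (grad u x) = \<bar>grad u x \<bullet> z\<bar> / (z \<bullet> z) * norm z"
    by (subst g) simp
  also have "\<dots> = \<bar>grad u x \<bullet> z\<bar> / norm z"
    using z by (simp add: dot_square_norm power2_eq_square)
  finally show ?thesis
    by (simp add: rad_deriv_def z_def[symmetric])
qed

section \<open>The weighted test function\<close>

lemma C1_on_mult_weight:
  fixes \<phi> :: "'a::euclidean_space \<Rightarrow> real" and y :: 'a and \<beta> :: real
  assumes "open V" "C1_on V \<phi>" "\<delta> > 0"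
  defines "s \<equiv> \<lambda>x. (norm (x - y))\<^sup>2 + \<delta>"
  defines "\<psi> \<equiv> \<lambda>x. \<phi> x * s x powr \<beta>"
  shows "C1_on V \<psi>"
    and "x \<in> V \<Longrightarrow> grad \<psi> x = (s x powr \<beta>) *\<^sub>R grad \<phi> x + (2 * \<beta> * \<phi> x * s x powr (\<beta> - 1)) *\<^sub>R (x - y)"
proof -
  have s: "s x > 0" for x using assms(3) by (simp add: s_def add_nonneg_pos)
  let ?g = "\<lambda>x. (s x powr \<beta>) *\<^sub>R grad \<phi> x + (2 * \<beta> * \<phi> x * s x powr (\<beta> - 1)) *\<^sub>R (x - y)"
  have d: "(\<psi> has_derivative (\<lambda>v. ?g x \<bullet> v)) (at x)" if "x \<in> V" for x
  proof -
    have d\<phi>: "(\<phi> has_derivative (\<lambda>v. grad \<phi> x \<bullet> v)) (at x)"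
      using assms(1,2) that by (auto simp: C1_on_def differentiable_on_eq_differentiable_at intro: has_derivative_grad)
    have ds: "(s has_derivative (\<lambda>v. 2 * ((x - y) \<bullet> v))) (at x)"
      unfolding s_def power2_norm_eq_inner
      by (auto intro!: derivative_eq_intros simp: inner_commute)
    have "((\<lambda>t. t powr \<beta>) has_real_derivative \<beta> * s x powr (\<beta> - 1)) (at (s x))"
      using s by (intro has_real_derivative_powr) auto
    then have "((\<lambda>x. s x powr \<beta>) has_derivative (\<lambda>v. 2 * ((x - y) \<bullet> v) * (\<beta> * s x powr (\<beta> - 1)))) (at x)"
      by (intro has_derivative_compose[OF ds, THEN has_derivative_eq_rhs])
        (auto simp: has_field_derivative_def fun_eq_iff mult.commute)
    from has_derivative_mult[OF d\<phi> this] show ?thesis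
      unfolding \<psi>_def by (rule has_derivative_eq_rhs) (auto simp: fun_eq_iff algebra_simps inner_add_left)
  qed
  then show g: "grad \<psi> x = ?g x" if "x \<in> V" for x
    using grad_eqI that by blast
  have "continuous_on V \<phi>" "continuous_on V (grad \<phi>)"
    using assms(2) by (auto simp: C1_on_def intro: differentiable_imp_continuous_on)
  moreover have "continuous_on V s" unfolding s_def by (intro continuous_intros)
  ultimately have "continuous_on V ?g"
    using s by (intro continuous_intros) (auto simp: less_imp_neq[symmetric])
  then have "continuous_on V (grad \<psi>)"
    using g by (simp cong: continuous_on_cong)
  moreover have "\<psi> differentiable_on V"
    using d by (auto simp: differentiable_on_def differentiable_def intro: has_derivative_at_withinI)
  ultimately show "C1_on V \<psi>" by (simp add: C1_on_def)
qed

context level_sets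
begin

text \<open>The gradient of the weight is a multiple of \<open>x - y\<close>, and the tangential
  part of \<open>x - y\<close> paired with \<open>x - y\<close> gives
  \<open>(norm (x - y))^2 - (\<nu> \<bullet> (x - y))^2\<close>. The exponent
  \<open>- \<alpha> / 4\<close> contributes \<open>- \<alpha> / 2\<close>, doubled by the factor
  \<open>2 \<psi>\<close>.\<close>

lemma curv_flux_weight:
  fixes y :: 'a
  assumes "open V" "C1_on V \<phi>" "\<delta> > 0" "x \<in> V"
  defines "s \<equiv> \<lambda>x. (norm (x - y))\<^sup>2 + \<delta>"
  shows "curv_flux (\<lambda>x. \<phi> x * s x powr (- \<alpha> / 4)) y x = norm (grad u x) * s x powr (- \<alpha> / 2) *
    ((real DIM('a) - 1) * (\<phi> x)\<^sup>2 - \<alpha> * (\<phi> x)\<^sup>2 * ((norm (x - y))\<^sup>2 - (unit_normal u x \<bullet> (x - y))\<^sup>2) / s x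
     + 2 * \<phi> x * (tan_grad u \<phi> x \<bullet> (x - y)) - (\<phi> x)\<^sup>2 * mean_curv u x * (unit_normal u x \<bullet> (x - y)))"
proof -
  have s: "s x > 0" using assms(3) by (simp add: s_def add_nonneg_pos)
  define p where "p = s x powr (- \<alpha> / 4)"
  have p2: "s x powr (- \<alpha> / 2) = p\<^sup>2"
    unfolding p_def power2_eq_square by (simp add: powr_add[symmetric])
  have p1: "s x powr (- \<alpha> / 4 - 1) = p / s x"
    using s by (simp add: p_def powr_diff)
  define \<nu> where "\<nu> = unit_normal u x"
  define z where "z = x - y"
  have g: "grad (\<lambda>x. \<phi> x * s x powr (- \<alpha> / 4)) x = p *\<^sub>R grad \<phi> x + (2 * (- \<alpha> / 4) * \<phi> x * (p / s x)) *\<^sub>R z"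
    using C1_on_mult_weight(2)[OF assms(1-4), of y "- \<alpha> / 4"] p1
    unfolding s_def p_def z_def by simp
  have t: "tan_grad u (\<lambda>x. \<phi> x * s x powr (- \<alpha> / 4)) x \<bullet> z
    = p * (tan_grad u \<phi> x \<bullet> z) - \<alpha> / 2 * \<phi> x * (p / s x) * ((norm z)\<^sup>2 - (\<nu> \<bullet> z)\<^sup>2)"
    unfolding tan_grad_def g \<nu>_def[symmetric] power2_norm_eq_inner
    by (simp add: algebra_simps inner_add_left inner_diff_left inner_commute power2_eq_square diff_divide_distrib)
  show ?thesis
    unfolding curv_flux_def z_def[symmetric] t p2 p_def[symmetric] \<nu>_def[symmetric]
    by (simp add: power2_eq_square algebra_simps add_divide_distrib diff_divide_distrib)
qed


definition weight :: "'a \<Rightarrow> real \<Rightarrow> real \<Rightarrow> 'a \<Rightarrow> real" where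
  "weight y \<alpha> \<delta> x = ((norm (x - y))\<^sup>2 + \<delta>) powr (- \<alpha> / 2)"

text \<open>The point y is left out because \<open>0 powr a = 0\<close> makes the limiting integrand
  0 at y, whereas \<open>weight\<close> is positive there for positive \<delta>. With y removed,
  convergence holds at every point.\<close>

definition mass :: "('a \<Rightarrow> real) \<Rightarrow> 'a \<Rightarrow> real \<Rightarrow> real \<Rightarrow> 'a \<Rightarrow> real" where
  "mass \<phi> y \<alpha> \<delta> x = indicator (\<Omega> - {y}) x * (norm (grad u x) * (\<phi> x)\<^sup>2 * weight y \<alpha> \<delta> x)"

text \<open>As u_r = |grad u| \<open>(\<nu> \<bullet> (x - y))\<close> / r, this is the regularized
  u_r^2 / |grad u| times the square of \<phi> and the weight.\<close>

definition radial_mass :: "('a \<Rightarrow> real) \<Rightarrow> 'a \<Rightarrow> real \<Rightarrow> real \<Rightarrow> 'a \<Rightarrow> real" where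
  "radial_mass \<phi> y \<alpha> \<delta> x = mass \<phi> y \<alpha> \<delta> x * ((unit_normal u x \<bullet> (x - y))\<^sup>2 / ((norm (x - y))\<^sup>2 + \<delta>))"

definition tan_energy :: "('a \<Rightarrow> real) \<Rightarrow> 'a \<Rightarrow> real" where
  "tan_energy \<phi> x = 4 * (norm (tan_grad u \<phi> x))\<^sup>2 + (mean_curv u x)\<^sup>2 * (\<phi> x)\<^sup>2"

definition energy :: "('a \<Rightarrow> real) \<Rightarrow> 'a \<Rightarrow> real \<Rightarrow> real \<Rightarrow> 'a \<Rightarrow> real" where
  "energy \<phi> y \<alpha> \<delta> x = indicator \<Omega> x * (norm (grad u x) * tan_energy \<phi> x * ((norm (x - y))\<^sup>2 * weight y \<alpha> \<delta> x))"

text \<open>The exponent \<open>- \<alpha> / 4\<close> makes the square of the test function carry the weight \<open>s powr (- \<alpha> / 2)\<close>.\<close>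

lemma mass_le_curv_flux:
  assumes "open V" "\<Omega> \<subseteq> V" "C1_on V \<phi>" "\<delta> > 0" "0 \<le> \<alpha>" "\<alpha> < real DIM('a) - 1"
  shows "(real DIM('a) - 1 - \<alpha>) * mass \<phi> y \<alpha> \<delta> x + \<alpha> * radial_mass \<phi> y \<alpha> \<delta> x
    \<le> indicator \<Omega> x * curv_flux (\<lambda>x. \<phi> x * ((norm (x - y))\<^sup>2 + \<delta>) powr (- \<alpha> / 4)) y x
      + sqrt (mass \<phi> y \<alpha> \<delta> x) * sqrt (energy \<phi> y \<alpha> \<delta> x)"
proof (cases "x \<in> \<Omega> \<and> grad u x \<noteq> 0")
  case False
  then show ?thesis
    by (auto simp: mass_def radial_mass_def energy_def curv_flux_def)
next
  case True
  then have x: "x \<in> \<Omega>" "x \<in> V" and a: "grad u x \<noteq> 0" using assms(2) by auto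
  define s where "s = (norm (x - y))\<^sup>2 + \<delta>"
  have s: "s > 0" using assms(4) by (simp add: s_def add_nonneg_pos)
  define W where "W = weight y \<alpha> \<delta> x"
  have W: "W \<ge> 0" by (simp add: W_def weight_def)
  define N where "N = norm (grad u x)"
  have N: "N \<ge> 0" by (simp add: N_def)
  define z where "z = x - y"
  define \<nu> where "\<nu> = unit_normal u x"
  define \<tau> where "\<tau> = tan_grad u \<phi> x"
  define H where "H = mean_curv u x"
  define n where "n = real DIM('a)"
  define X where "X = tan_energy \<phi> x"
  have X: "X \<ge> 0" by (simp add: X_def tan_energy_def)
  have \<nu>: "norm \<nu> = 1" using a by (simp add: \<nu>_def unit_normal_def)
  then have "\<nu> \<bullet> \<nu> = 1" by (simp add: dot_square_norm)
  then have \<tau>: "\<tau> \<bullet> \<nu> = 0" by (simp add: \<tau>_def tan_grad_def \<nu>_def[symmetric] inner_diff_left)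
  have cf: "curv_flux (\<lambda>x. \<phi> x * ((norm (x - y))\<^sup>2 + \<delta>) powr (- \<alpha> / 4)) y x
    = N * W * ((n - 1) * (\<phi> x)\<^sup>2 - \<alpha> * (\<phi> x)\<^sup>2 * ((norm z)\<^sup>2 - (\<nu> \<bullet> z)\<^sup>2) / s
      + 2 * \<phi> x * (\<tau> \<bullet> z) - (\<phi> x)\<^sup>2 * H * (\<nu> \<bullet> z))"
    unfolding curv_flux_weight[OF assms(1,3,4) x(2)]
    by (simp add: N_def W_def weight_def n_def z_def \<nu>_def s_def \<tau>_def H_def)
  have T: "sqrt (mass \<phi> y \<alpha> \<delta> x) * sqrt (energy \<phi> y \<alpha> \<delta> x) = N * W * (\<bar>\<phi> x\<bar> * norm z * sqrt X)"
  proof (cases "x = y")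
    case True
    then show ?thesis by (simp add: mass_def z_def)
  next
    case False
    have "sqrt (mass \<phi> y \<alpha> \<delta> x) * sqrt (energy \<phi> y \<alpha> \<delta> x) = sqrt ((N * W * (\<phi> x * norm z))\<^sup>2 * X)"
      unfolding real_sqrt_mult[symmetric] using False x(1)
      by (simp add: mass_def energy_def N_def[symmetric] W_def[symmetric] X_def[symmetric] z_def[symmetric]
          power2_eq_square algebra_simps)
    also have "\<dots> = \<bar>N * W * (\<phi> x * norm z)\<bar> * sqrt X"
      by (simp only: real_sqrt_mult real_sqrt_abs)
    finally show ?thesis using N W by (simp add: abs_mult)
  qed
  \<comment> \<open>The two sides differ by \<open>\<alpha> \<phi>^2 (1 - (norm z)^2 / s)\<close>,
    which is nonnegative and would be 0 for \<open>\<delta> = 0\<close>, z nonzero.\<close>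
  have "(n - 1 - \<alpha>) * (\<phi> x)\<^sup>2 + \<alpha> * (\<phi> x)\<^sup>2 * (\<nu> \<bullet> z)\<^sup>2 / s
    \<le> (n - 1) * (\<phi> x)\<^sup>2 - \<alpha> * (\<phi> x)\<^sup>2 * ((norm z)\<^sup>2 - (\<nu> \<bullet> z)\<^sup>2) / s"
  proof -
    have "(norm z)\<^sup>2 / s \<le> 1" using s assms(4) by (simp add: s_def z_def)
    then have "\<alpha> * (\<phi> x)\<^sup>2 * ((norm z)\<^sup>2 / s) \<le> \<alpha> * (\<phi> x)\<^sup>2 * 1"
      using assms(5) by (intro mult_left_mono) auto
    then show ?thesis
      by (simp add: algebra_simps diff_divide_distrib)
  qed
  moreover have "(\<phi> x)\<^sup>2 * H * (\<nu> \<bullet> z) - 2 * \<phi> x * (\<tau> \<bullet> z) \<le> \<bar>\<phi> x\<bar> * norm z * sqrt X"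
    using tangential_normal_le[OF \<nu> \<tau>, of "\<phi> x" H z]
    by (simp add: X_def tan_energy_def \<tau>_def H_def)
  ultimately have "(n - 1 - \<alpha>) * (\<phi> x)\<^sup>2 + \<alpha> * (\<phi> x)\<^sup>2 * (\<nu> \<bullet> z)\<^sup>2 / s
    \<le> ((n - 1) * (\<phi> x)\<^sup>2 - \<alpha> * (\<phi> x)\<^sup>2 * ((norm z)\<^sup>2 - (\<nu> \<bullet> z)\<^sup>2) / s
      + 2 * \<phi> x * (\<tau> \<bullet> z) - (\<phi> x)\<^sup>2 * H * (\<nu> \<bullet> z)) + \<bar>\<phi> x\<bar> * norm z * sqrt X"
    by linarith
  then have "N * W * ((n - 1 - \<alpha>) * (\<phi> x)\<^sup>2 + \<alpha> * (\<phi> x)\<^sup>2 * (\<nu> \<bullet> z)\<^sup>2 / s)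
    \<le> N * W * (((n - 1) * (\<phi> x)\<^sup>2 - \<alpha> * (\<phi> x)\<^sup>2 * ((norm z)\<^sup>2 - (\<nu> \<bullet> z)\<^sup>2) / s
      + 2 * \<phi> x * (\<tau> \<bullet> z) - (\<phi> x)\<^sup>2 * H * (\<nu> \<bullet> z)) + \<bar>\<phi> x\<bar> * norm z * sqrt X)"
    using N W by (intro mult_left_mono) auto
  also have "\<dots> = indicator \<Omega> x * curv_flux (\<lambda>x. \<phi> x * ((norm (x - y))\<^sup>2 + \<delta>) powr (- \<alpha> / 4)) y x
      + sqrt (mass \<phi> y \<alpha> \<delta> x) * sqrt (energy \<phi> y \<alpha> \<delta> x)"
    unfolding T cf using x by (simp add: distrib_left)
  also have "(real DIM('a) - 1 - \<alpha>) * mass \<phi> y \<alpha> \<delta> x + \<alpha> * radial_mass \<phi> y \<alpha> \<delta> x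
    \<le> N * W * ((n - 1 - \<alpha>) * (\<phi> x)\<^sup>2 + \<alpha> * (\<phi> x)\<^sup>2 * (\<nu> \<bullet> z)\<^sup>2 / s)"
  \<comment> \<open>At y the left side is 0, as \<open>mass\<close> leaves y out; the right side is
    nonnegative since \<open>\<alpha> < n - 1\<close>.\<close>
  proof (cases "x = y")
    case True
    then show ?thesis
      using N W assms(6) by (simp add: mass_def radial_mass_def z_def n_def)
  next
    case False
    then show ?thesis
      using x(1) by (simp add: mass_def radial_mass_def N_def W_def n_def \<nu>_def z_def s_def algebra_simps)
  qed
  finally show ?thesis .
qed

lemma measurable_mass:
  assumes "\<Omega> \<subseteq> V" "C1_on V \<phi>"
  shows "mass \<phi> y \<alpha> \<delta> \<in> borel_measurable borel"
    "radial_mass \<phi> y \<alpha> \<delta> \<in> borel_measurable borel"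
    "energy \<phi> y \<alpha> \<delta> \<in> borel_measurable borel"
proof -
  define a where "a x = indicator \<Omega> x *\<^sub>R grad u x" for x
  define h where "h x = indicator {x \<in> \<Omega>. grad u x \<noteq> 0} x *\<^sub>R mean_curv u x" for x
  define f where "f x = indicator \<Omega> x *\<^sub>R \<phi> x" for x
  define g where "g x = indicator \<Omega> x *\<^sub>R grad \<phi> x" for x
  have "continuous_on V \<phi>" "continuous_on V (grad \<phi>)"
    using assms(2) by (auto simp: C1_on_def intro: differentiable_imp_continuous_on)
  then have [measurable]: "f \<in> borel_measurable borel" "g \<in> borel_measurable borel"
    unfolding f_def[abs_def] g_def[abs_def] by (blast intro: measurable_restrict[OF _ assms(1)])+
  have [measurable]: "a \<in> borel_measurable borel" "h \<in> borel_measurable borel"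
    unfolding a_def[abs_def] h_def[abs_def] using measurable_grad measurable_mean_curv by auto
  define \<nu> where "\<nu> x = (1 / norm (a x)) *\<^sub>R a x" for x
  have [measurable]: "\<nu> \<in> borel_measurable borel"
    unfolding \<nu>_def[abs_def] by measurable
  have W[measurable]: "weight y \<alpha> \<delta> \<in> borel_measurable borel"
    unfolding weight_def[abs_def] by measurable
  have [measurable]: "\<Omega> - {y} \<in> sets borel" by measurable
  have m: "mass \<phi> y \<alpha> \<delta> = (\<lambda>x. indicator (\<Omega> - {y}) x * (norm (a x) * (f x)\<^sup>2 * weight y \<alpha> \<delta> x))"
    by (auto simp: mass_def a_def f_def fun_eq_iff indicator_def)
  show [measurable]: "mass \<phi> y \<alpha> \<delta> \<in> borel_measurable borel"
    unfolding m by measurable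
  have "radial_mass \<phi> y \<alpha> \<delta> = (\<lambda>x. mass \<phi> y \<alpha> \<delta> x * ((\<nu> x \<bullet> (x - y))\<^sup>2 / ((norm (x - y))\<^sup>2 + \<delta>)))"
    by (auto simp: radial_mass_def mass_def a_def unit_normal_def \<nu>_def fun_eq_iff indicator_def)
  then show "radial_mass \<phi> y \<alpha> \<delta> \<in> borel_measurable borel"
    by simp
  have "energy \<phi> y \<alpha> \<delta> x = norm (a x) * (4 * (norm (g x - (g x \<bullet> \<nu> x) *\<^sub>R \<nu> x))\<^sup>2 + (h x)\<^sup>2 * (f x)\<^sup>2)
      * ((norm (x - y))\<^sup>2 * weight y \<alpha> \<delta> x)" for x
    by (cases "x \<in> \<Omega>"; cases "grad u x = 0")
      (auto simp: energy_def tan_energy_def a_def h_def f_def g_def \<nu>_def tan_grad_def unit_normal_def)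
  then have "energy \<phi> y \<alpha> \<delta> = (\<lambda>x. norm (a x) * (4 * (norm (g x - (g x \<bullet> \<nu> x) *\<^sub>R \<nu> x))\<^sup>2 + (h x)\<^sup>2 * (f x)\<^sup>2)
      * ((norm (x - y))\<^sup>2 * weight y \<alpha> \<delta> x))"
    by (rule ext)
  moreover have "(\<lambda>x. norm (a x) * (4 * (norm (g x - (g x \<bullet> \<nu> x) *\<^sub>R \<nu> x))\<^sup>2 + (h x)\<^sup>2 * (f x)\<^sup>2)
      * ((norm (x - y))\<^sup>2 * weight y \<alpha> \<delta> x)) \<in> borel_measurable borel"
    by measurable
  ultimately show "energy \<phi> y \<alpha> \<delta> \<in> borel_measurable borel" by simp
qed

lemma mass_nonneg: "0 \<le> mass \<phi> y \<alpha> \<delta> x" "0 \<le> energy \<phi> y \<alpha> \<delta> x"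
  by (auto simp: mass_def energy_def tan_energy_def weight_def)

lemma radial_mass_nonneg: "0 \<le> \<delta> \<Longrightarrow> 0 \<le> radial_mass \<phi> y \<alpha> \<delta> x"
  using mass_nonneg by (simp add: radial_mass_def)

text \<open>For positive \<delta> the weight is bounded. This finiteness permits the cancellation of
  a square root before \<delta> is removed.\<close>

lemma nn_integral_mass_finite:
  assumes "closure \<Omega> \<subseteq> V" "C1_on V \<phi>" "0 < \<delta>"
  shows "(\<integral>\<^sup>+ x. ennreal (mass \<phi> y \<alpha> \<delta> x) \<partial>lborel) \<noteq> \<infinity>"
proof -
  have s: "(norm (x - y))\<^sup>2 + \<delta> \<noteq> 0" for x using assms(3) by (metis add_nonneg_pos less_irrefl zero_le_power2)
  have "continuous_on V \<phi>" using assms(2) by (auto simp: C1_on_def intro: differentiable_imp_continuous_on)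
  then have "continuous_on (V \<inter> U) (\<lambda>x. norm (grad u x) * (\<phi> x)\<^sup>2 * weight y \<alpha> \<delta> x)"
    unfolding weight_def using s continuous_on_grad[OF smooth]
    by (intro continuous_intros) (auto intro: continuous_on_subset)
  then have "bounded ((\<lambda>x. norm (grad u x) * (\<phi> x)\<^sup>2 * weight y \<alpha> \<delta> x) ` \<Omega>)"
    by (rule bounded_image) (use assms(1) closure_subset_U in auto)
  then obtain C where C: "\<And>x. x \<in> \<Omega> \<Longrightarrow> norm (grad u x) * (\<phi> x)\<^sup>2 * weight y \<alpha> \<delta> x \<le> C"
    by (auto simp: bounded_iff) (meson abs_le_D1)
  have "integrable lborel (mass \<phi> y \<alpha> \<delta>)"
  proof (rule Bochner_Integration.integrable_bound[OF integrable_const_indicator[of C]])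
    show "AE x in lborel. norm (mass \<phi> y \<alpha> \<delta> x) \<le> norm (C * indicator \<Omega> x)"
    proof (rule AE_I2)
      fix x show "norm (mass \<phi> y \<alpha> \<delta> x) \<le> norm (C * indicator \<Omega> x)"
        using C[of x] mass_nonneg[of \<phi> y \<alpha> \<delta> x] by (auto simp: mass_def indicator_def)
    qed
    have "\<Omega> \<subseteq> V" using assms(1) closure_subset by blast
    then show "mass \<phi> y \<alpha> \<delta> \<in> borel_measurable lborel"
      using measurable_mass(1)[OF _ assms(2)] by simp
  qed
  then show ?thesis
    by (subst nn_integral_eq_integral) (auto simp: mass_nonneg)
qed

text \<open>Integrates \<open>mass_le_curv_flux\<close>: the flux term contributes 0 under either
  boundary condition, as the test function inherits the zeros of \<phi>. The squared form is the one
  that Cauchy-Schwarz for nonnegative integrals delivers.\<close>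

lemma weighted_estimate:
  assumes V: "open V" "closure \<Omega> \<subseteq> V" and \<phi>: "C1_on V \<phi>" and \<delta>: "0 < \<delta>"
    and \<alpha>: "0 \<le> \<alpha>" "\<alpha> < real DIM('a) - 1"
    and null: "AE x in lborel. x \<in> \<Omega> \<and> u x = 0 \<longrightarrow> grad u x = 0"
    and bc: "(\<forall>x\<in>frontier \<Omega>. u x = 0) \<or> (\<forall>x\<in>frontier \<Omega>. \<phi> x = 0)"
  shows "(ennreal (real DIM('a) - 1 - \<alpha>) * (\<integral>\<^sup>+ x. ennreal (mass \<phi> y \<alpha> \<delta> x) \<partial>lborel)
      + ennreal \<alpha> * (\<integral>\<^sup>+ x. ennreal (radial_mass \<phi> y \<alpha> \<delta> x) \<partial>lborel))\<^sup>2
    \<le> (\<integral>\<^sup>+ x. ennreal (mass \<phi> y \<alpha> \<delta> x) \<partial>lborel) * (\<integral>\<^sup>+ x. ennreal (energy \<phi> y \<alpha> \<delta> x) \<partial>lborel)"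
proof -
  have \<Omega>V: "\<Omega> \<subseteq> V" using V closure_subset by blast
  define \<psi> where "\<psi> x = \<phi> x * ((norm (x - y))\<^sup>2 + \<delta>) powr (- \<alpha> / 4)" for x
  define f where "f x = (real DIM('a) - 1 - \<alpha>) * mass \<phi> y \<alpha> \<delta> x + \<alpha> * radial_mass \<phi> y \<alpha> \<delta> x" for x
  define T where "T x = sqrt (mass \<phi> y \<alpha> \<delta> x) * sqrt (energy \<phi> y \<alpha> \<delta> x)" for x
  note meas[measurable] = measurable_mass[OF \<Omega>V \<phi>]
  have C1\<psi>: "C1_on V \<psi>" unfolding \<psi>_def[abs_def] by (rule C1_on_mult_weight(1)[OF V(1) \<phi> \<delta>])
  have I0: "(\<integral>x. indicator \<Omega> x * curv_flux \<psi> y x \<partial>lborel) = 0"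
    using bc
  proof
    assume "\<forall>x\<in>frontier \<Omega>. u x = 0"
    then show ?thesis by (intro integral_curv_flux_eq_0_level[OF V C1\<psi> _ null]) auto
  next
    assume "\<forall>x\<in>frontier \<Omega>. \<phi> x = 0"
    then show ?thesis by (intro integral_curv_flux_eq_0_vanishing[OF V C1\<psi>]) (auto simp: \<psi>_def)
  qed
  have f0: "0 \<le> f x" for x
    unfolding f_def using \<alpha> \<delta> by (intro add_nonneg_nonneg mult_nonneg_nonneg mass_nonneg radial_mass_nonneg) auto
  have T0: "0 \<le> T x" for x by (simp add: T_def mass_nonneg)
  have fT: "f x \<le> indicator \<Omega> x * curv_flux \<psi> y x + T x" for x
    unfolding f_def T_def \<psi>_def by (rule mass_le_curv_flux[OF V(1) \<Omega>V \<phi> \<delta> \<alpha>])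
  have mf[measurable]: "f \<in> borel_measurable borel" and mT[measurable]: "T \<in> borel_measurable borel"
    unfolding f_def[abs_def] T_def[abs_def] by measurable
  have le: "(\<integral>\<^sup>+ x. ennreal (f x) \<partial>lborel) \<le> (\<integral>\<^sup>+ x. ennreal (T x) \<partial>lborel)"
  \<comment> \<open>An infinite right-hand side leaves nothing to prove. Otherwise T is integrable,
    f is dominated by an integrable function, and real integrals can be compared.\<close>
  proof (cases "(\<integral>\<^sup>+ x. ennreal (T x) \<partial>lborel) = \<infinity>")
    case False
    then have iT: "integrable lborel T"
      by (intro integrableI_nonneg) (auto simp: T0 less_top)
    have iJ: "integrable lborel (\<lambda>x. indicator \<Omega> x * curv_flux \<psi> y x)"
      by (rule integrable_curv_flux[OF V C1\<psi>])
    have if': "integrable lborel f"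
    proof (rule Bochner_Integration.integrable_bound[OF Bochner_Integration.integrable_add[OF iJ iT]])
      show "AE x in lborel. norm (f x) \<le> norm (indicator \<Omega> x * curv_flux \<psi> y x + T x)"
      proof (rule AE_I2)
        fix x show "norm (f x) \<le> norm (indicator \<Omega> x * curv_flux \<psi> y x + T x)"
          using fT[of x] f0[of x] by simp
      qed
    qed simp
    have "integral\<^sup>L lborel f \<le> (\<integral>x. indicator \<Omega> x * curv_flux \<psi> y x + T x \<partial>lborel)"
      by (rule integral_mono[OF if' Bochner_Integration.integrable_add[OF iJ iT] fT])
    also have "\<dots> = integral\<^sup>L lborel T"
      using I0 by (simp add: Bochner_Integration.integral_add[OF iJ iT])
    finally show ?thesis
      using nn_integral_eq_integral[OF if'] nn_integral_eq_integral[OF iT] f0 T0 by (simp add: ennreal_leI)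
  qed simp
  have "ennreal (real DIM('a) - 1 - \<alpha>) * (\<integral>\<^sup>+ x. ennreal (mass \<phi> y \<alpha> \<delta> x) \<partial>lborel)
      + ennreal \<alpha> * (\<integral>\<^sup>+ x. ennreal (radial_mass \<phi> y \<alpha> \<delta> x) \<partial>lborel) = (\<integral>\<^sup>+ x. ennreal (f x) \<partial>lborel)"
  proof -
    have "ennreal (f x) = ennreal (real DIM('a) - 1 - \<alpha>) * ennreal (mass \<phi> y \<alpha> \<delta> x) + ennreal \<alpha> * ennreal (radial_mass \<phi> y \<alpha> \<delta> x)" for x
      unfolding f_def using \<alpha> \<delta> by (simp add: ennreal_mult ennreal_plus mass_nonneg radial_mass_nonneg)
    then show ?thesis by (simp add: nn_integral_add nn_integral_cmult)
  qed
  also have "(\<integral>\<^sup>+ x. ennreal (f x) \<partial>lborel)\<^sup>2 \<le> (\<integral>\<^sup>+ x. ennreal (T x) \<partial>lborel)\<^sup>2"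
    by (intro power_mono le) simp
  also have "\<dots> = (\<integral>\<^sup>+ x. ennreal (sqrt (mass \<phi> y \<alpha> \<delta> x)) * ennreal (sqrt (energy \<phi> y \<alpha> \<delta> x)) \<partial>lborel)\<^sup>2"
    by (simp add: T_def ennreal_mult mass_nonneg)
  also have "\<dots> \<le> (\<integral>\<^sup>+ x. (ennreal (sqrt (mass \<phi> y \<alpha> \<delta> x)))\<^sup>2 \<partial>lborel) * (\<integral>\<^sup>+ x. (ennreal (sqrt (energy \<phi> y \<alpha> \<delta> x)))\<^sup>2 \<partial>lborel)"
    by (rule Cauchy_Schwarz_nn_integral) auto
  finally show ?thesis
    by (simp add: ennreal_power mass_nonneg)
qed

end

subsection \<open>Removing the regularization of the weight\<close>

context level_sets
begin

lemma weight_antimono: "0 < \<delta> \<Longrightarrow> \<delta> \<le> \<delta>' \<Longrightarrow> 0 \<le> \<alpha> \<Longrightarrow> weight y \<alpha> \<delta>' x \<le> weight y \<alpha> \<delta> x"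
  unfolding weight_def by (intro powr_mono2') (auto simp: add_nonneg_pos)

lemma weight_0: "x \<noteq> y \<Longrightarrow> weight y \<alpha> 0 x = dist x y powr (- \<alpha>)"
proof -
  assume "x \<noteq> y"
  then have "(norm (x - y))\<^sup>2 = norm (x - y) powr 2" by simp
  then have "((norm (x - y))\<^sup>2) powr (- \<alpha> / 2) = norm (x - y) powr (2 * (- \<alpha> / 2))"
    by (simp only: powr_powr)
  then show ?thesis by (simp add: weight_def dist_norm)
qed

lemma tendsto_weight:
  assumes "x \<noteq> y" "(e \<longlongrightarrow> 0) F"
  shows "((\<lambda>k. weight y \<alpha> (e k) x) \<longlongrightarrow> dist x y powr (- \<alpha>)) F"
proof -
  have "((\<lambda>k. weight y \<alpha> (e k) x) \<longlongrightarrow> ((norm (x - y))\<^sup>2 + 0) powr (- \<alpha> / 2)) F"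
    unfolding weight_def using assms by (intro tendsto_intros) auto
  then show ?thesis
    using weight_0[OF assms(1), of \<alpha>] by (simp add: weight_def)
qed

text \<open>On the right of the estimate an upper bound replaces convergence: the weight is largest
  at \<open>\<delta> = 0\<close>, and at y the factor \<open>(norm (x - y))^2\<close>
  vanishes.\<close>

lemma energy_le:
  assumes "0 < \<delta>" "0 \<le> \<alpha>"
  shows "ennreal (energy \<phi> y \<alpha> \<delta> x) \<le> ennreal (norm (grad u x) * tan_energy \<phi> x * dist x y powr (2 - \<alpha>))
      * indicator (\<Omega> \<inter> {x. norm (grad u x) > 0}) x"
proof (cases "x \<in> \<Omega> \<and> grad u x \<noteq> 0")
  case True
  have "(norm (x - y))\<^sup>2 * weight y \<alpha> \<delta> x \<le> dist x y powr (2 - \<alpha>)"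
  proof (cases "x = y")
    case False
    have "weight y \<alpha> \<delta> x \<le> weight y \<alpha> 0 x"
      unfolding weight_def using assms False by (intro powr_mono2') auto
    then have "(norm (x - y))\<^sup>2 * weight y \<alpha> \<delta> x \<le> (norm (x - y))\<^sup>2 * dist x y powr (- \<alpha>)"
      unfolding weight_0[OF False] by (intro mult_left_mono) auto
    also have "\<dots> = dist x y powr (2 - \<alpha>)"
      using False by (simp add: dist_norm powr_diff powr_minus divide_inverse)
    finally show ?thesis .
  qed simp
  moreover have "0 \<le> tan_energy \<phi> x" by (simp add: tan_energy_def)
  ultimately have "energy \<phi> y \<alpha> \<delta> x \<le> norm (grad u x) * tan_energy \<phi> x * dist x y powr (2 - \<alpha>)"
    using True by (auto simp: energy_def intro!: mult_left_mono mult_nonneg_nonneg)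
  then show ?thesis using True by (simp add: ennreal_leI)
qed (auto simp: energy_def)

text \<open>Lowering \<delta> raises the weight and, in \<open>radial_mass\<close>, also the
  reciprocal of the squared distance plus \<delta>, so monotone convergence applies to both
  integrals.\<close>

lemma nn_integral_mass_LIMSEQ:
  fixes e :: "nat \<Rightarrow> real"
  assumes V: "\<Omega> \<subseteq> V" "C1_on V \<phi>" and \<alpha>: "0 \<le> \<alpha>"
    and e: "\<And>k. 0 < e k" "decseq e" "e \<longlonglongrightarrow> 0"
  shows "incseq (\<lambda>k. \<integral>\<^sup>+ x. ennreal (mass \<phi> y \<alpha> (e k) x) \<partial>lborel)"
    and "(\<lambda>k. \<integral>\<^sup>+ x. ennreal (mass \<phi> y \<alpha> (e k) x) \<partial>lborel) \<longlonglongrightarrow>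
      (\<integral>\<^sup>+ x. ennreal (norm (grad u x) * (\<phi> x)\<^sup>2 * dist x y powr (-\<alpha>)) * indicator \<Omega> x \<partial>lborel)"
    and "(\<lambda>k. \<integral>\<^sup>+ x. ennreal (radial_mass \<phi> y \<alpha> (e k) x) \<partial>lborel) \<longlonglongrightarrow>
      (\<integral>\<^sup>+ x. ennreal ((rad_deriv u y x)\<^sup>2 / norm (grad u x) * (\<phi> x)\<^sup>2 * dist x y powr (-\<alpha>))
        * indicator \<Omega> x \<partial>lborel)"
proof -
  have mono: "mass \<phi> y \<alpha> (e k) x \<le> mass \<phi> y \<alpha> (e (Suc k)) x" for k x
    unfolding mass_def using e(1) decseq_SucD[OF e(2)] \<alpha>
    by (intro mult_left_mono weight_antimono) auto
  have mono2: "radial_mass \<phi> y \<alpha> (e k) x \<le> radial_mass \<phi> y \<alpha> (e (Suc k)) x" for k x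
    unfolding radial_mass_def using e(1)[of k] e(1)[of "Suc k"] decseq_SucD[OF e(2), of k]
    by (intro mult_mono mono divide_left_mono mass_nonneg mult_pos_pos add_nonneg_pos divide_nonneg_nonneg) auto
  have inc: "incseq (\<lambda>k x. ennreal (mass \<phi> y \<alpha> (e k) x))"
    by (intro incseq_SucI le_funI ennreal_leI mono)
  have inc2: "incseq (\<lambda>k x. ennreal (radial_mass \<phi> y \<alpha> (e k) x))"
    by (intro incseq_SucI le_funI ennreal_leI mono2)
  show "incseq (\<lambda>k. \<integral>\<^sup>+ x. ennreal (mass \<phi> y \<alpha> (e k) x) \<partial>lborel)"
    by (intro incseq_SucI nn_integral_mono ennreal_leI mono)
  have lim: "(\<lambda>k. mass \<phi> y \<alpha> (e k) x) \<longlonglongrightarrow> indicator (\<Omega> - {y}) x * (norm (grad u x) * (\<phi> x)\<^sup>2 * dist x y powr (-\<alpha>))" for x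
  proof (cases "x = y")
    case False
    then show ?thesis unfolding mass_def by (intro tendsto_intros tendsto_weight e(3))
  qed (simp add: mass_def)
  have l1: "(\<lambda>k. ennreal (mass \<phi> y \<alpha> (e k) x)) \<longlonglongrightarrow> ennreal (norm (grad u x) * (\<phi> x)\<^sup>2 * dist x y powr (-\<alpha>)) * indicator \<Omega> x" for x
  proof -
    have "ennreal (norm (grad u x) * (\<phi> x)\<^sup>2 * dist x y powr (-\<alpha>)) * indicator \<Omega> x
      = ennreal (indicator (\<Omega> - {y}) x * (norm (grad u x) * (\<phi> x)\<^sup>2 * dist x y powr (-\<alpha>)))"
      by (auto simp: indicator_def)
    then show ?thesis using tendsto_ennrealI[OF lim[of x]] by simp
  qed
  show "(\<lambda>k. \<integral>\<^sup>+ x. ennreal (mass \<phi> y \<alpha> (e k) x) \<partial>lborel) \<longlonglongrightarrow>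
      (\<integral>\<^sup>+ x. ennreal (norm (grad u x) * (\<phi> x)\<^sup>2 * dist x y powr (-\<alpha>)) * indicator \<Omega> x \<partial>lborel)"
    by (rule nn_integral_LIMSEQ[OF inc _ l1]) (use measurable_mass(1)[OF V] in simp)
  have l2: "(\<lambda>k. ennreal (radial_mass \<phi> y \<alpha> (e k) x)) \<longlonglongrightarrow>
      ennreal ((rad_deriv u y x)\<^sup>2 / norm (grad u x) * (\<phi> x)\<^sup>2 * dist x y powr (-\<alpha>)) * indicator \<Omega> x" for x
  proof (cases "x \<in> \<Omega> \<and> x \<noteq> y \<and> grad u x \<noteq> 0")
    case True
    then have "norm (x - y) \<noteq> 0" "norm (grad u x) \<noteq> 0" by auto
    then have eq: "norm (grad u x) * (\<phi> x)\<^sup>2 * dist x y powr (-\<alpha>) * ((unit_normal u x \<bullet> (x - y))\<^sup>2 / ((norm (x - y))\<^sup>2 + 0))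
      = (rad_deriv u y x)\<^sup>2 / norm (grad u x) * (\<phi> x)\<^sup>2 * dist x y powr (-\<alpha>)"
      unfolding rad_deriv_def unit_normal_def inner_scaleR_left inner_scaleR_right
      by (simp add: power2_eq_square divide_simps)
    have "(\<lambda>k. radial_mass \<phi> y \<alpha> (e k) x) \<longlonglongrightarrow> indicator (\<Omega> - {y}) x * (norm (grad u x) * (\<phi> x)\<^sup>2 * dist x y powr (-\<alpha>))
        * ((unit_normal u x \<bullet> (x - y))\<^sup>2 / ((norm (x - y))\<^sup>2 + 0))"
      unfolding radial_mass_def using True by (intro tendsto_intros lim e(3)) auto
    then show ?thesis using True tendsto_ennrealI unfolding eq[symmetric] by fastforce
  \<comment> \<open>At critical points division by 0 gives 0, the stipulated value of the integrand;
    at y both sides are 0 as well.\<close>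
  next
    case False
    then show ?thesis by (auto simp: radial_mass_def mass_def)
  qed
  show "(\<lambda>k. \<integral>\<^sup>+ x. ennreal (radial_mass \<phi> y \<alpha> (e k) x) \<partial>lborel) \<longlonglongrightarrow>
      (\<integral>\<^sup>+ x. ennreal ((rad_deriv u y x)\<^sup>2 / norm (grad u x) * (\<phi> x)\<^sup>2 * dist x y powr (-\<alpha>))
        * indicator \<Omega> x \<partial>lborel)"
    by (rule nn_integral_LIMSEQ[OF inc2 _ l2]) (use measurable_mass(2)[OF V] in simp)
qed

end

section \<open>The limit of vanishing regularization and the three inequalities\<close>

theorem theorem1p4:
  fixes \<Omega> :: "'a::euclidean_space set" and u \<phi> :: "'a \<Rightarrow> real"
    and \<alpha> :: real and y :: 'a
  assumes "DIM('a) \<ge> 2"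
    and "smooth_bounded_domain \<Omega>"
    and "smooth_on_closure \<Omega> u"
    and "C1_on_closure \<Omega> \<phi>"
    and "0 \<le> \<alpha>" and "\<alpha> < real DIM('a) - 1"
    and "(\<forall>x\<in>frontier \<Omega>. u x = 0) \<or> (\<forall>x\<in>frontier \<Omega>. \<phi> x = 0)"
  shows
    "(ennreal (real DIM('a) - 1 - \<alpha>) *
        (\<integral>\<^sup>+ x. ennreal (norm (grad u x) * (\<phi> x)\<^sup>2 * dist x y powr (-\<alpha>)) * indicator \<Omega> x \<partial>lborel)
      + ennreal \<alpha> *
        (\<integral>\<^sup>+ x. ennreal ((rad_deriv u y x)\<^sup>2 / norm (grad u x) * (\<phi> x)\<^sup>2 * dist x y powr (-\<alpha>))
                 * indicator \<Omega> x \<partial>lborel)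
    \<le> ennsqrt (\<integral>\<^sup>+ x. ennreal (norm (grad u x) * (\<phi> x)\<^sup>2 * dist x y powr (-\<alpha>)) * indicator \<Omega> x \<partial>lborel)
      * ennsqrt (\<integral>\<^sup>+ x. ennreal (norm (grad u x) *
               (4 * (norm (tan_grad u \<phi> x))\<^sup>2 + (mean_curv u x)\<^sup>2 * (\<phi> x)\<^sup>2) * dist x y powr (2 - \<alpha>))
             * indicator (\<Omega> \<inter> {x. norm (grad u x) > 0}) x \<partial>lborel))
   \<and> (ennreal ((real DIM('a) - 1 - \<alpha>)\<^sup>2) *
        (\<integral>\<^sup>+ x. ennreal (norm (grad u x) * (\<phi> x)\<^sup>2 * dist x y powr (-\<alpha>)) * indicator \<Omega> x \<partial>lborel)
    \<le> (\<integral>\<^sup>+ x. ennreal (norm (grad u x) *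
               (4 * (norm (tan_grad u \<phi> x))\<^sup>2 + (mean_curv u x)\<^sup>2 * (\<phi> x)\<^sup>2) * dist x y powr (2 - \<alpha>))
             * indicator (\<Omega> \<inter> {x. norm (grad u x) > 0}) x \<partial>lborel))
   \<and> ((\<exists>g. \<forall>x\<in>closure \<Omega>. u x = g (dist x y)) \<longrightarrow>
     ennreal ((real DIM('a) - 1)\<^sup>2) *
        (\<integral>\<^sup>+ x. ennreal (\<bar>rad_deriv u y x\<bar> * (\<phi> x)\<^sup>2 * dist x y powr (-\<alpha>)) * indicator \<Omega> x \<partial>lborel)
    \<le> (\<integral>\<^sup>+ x. ennreal (\<bar>rad_deriv u y x\<bar> *
               (4 * (norm (tan_grad u \<phi> x))\<^sup>2 + (mean_curv u x)\<^sup>2 * (\<phi> x)\<^sup>2) * dist x y powr (2 - \<alpha>))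
             * indicator (\<Omega> \<inter> {x. norm (grad u x) > 0}) x \<partial>lborel))"
proof -
  obtain U where U: "open U" "closure \<Omega> \<subseteq> U" "smooth_on U u"
    using assms(3) by (auto simp: smooth_on_closure_def)
  obtain V where V: "open V" "closure \<Omega> \<subseteq> V" and \<phi>: "C1_on V \<phi>"
    using assms(4) by (auto simp: C1_on_closure_def)
  obtain \<rho> where \<rho>: "smooth_on UNIV \<rho>" "\<Omega> = {x. \<rho> x < 0}"
    using assms(2) by (auto simp: smooth_bounded_domain_def)
  interpret level_sets \<Omega> U u
    using assms(2) U by unfold_locales (auto simp: smooth_bounded_domain_def)
  have \<Omega>V: "\<Omega> \<subseteq> V" using V closure_subset by blast
  let ?c = "real DIM('a) - 1 - \<alpha>"
  define A where "A = (\<integral>\<^sup>+ x. ennreal (norm (grad u x) * (\<phi> x)\<^sup>2 * dist x y powr (-\<alpha>)) * indicator \<Omega> x \<partial>lborel)"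
  define D where "D = (\<integral>\<^sup>+ x. ennreal ((rad_deriv u y x)\<^sup>2 / norm (grad u x) * (\<phi> x)\<^sup>2 * dist x y powr (-\<alpha>))
                 * indicator \<Omega> x \<partial>lborel)"
  define B where "B = (\<integral>\<^sup>+ x. ennreal (norm (grad u x) *
               (4 * (norm (tan_grad u \<phi> x))\<^sup>2 + (mean_curv u x)\<^sup>2 * (\<phi> x)\<^sup>2) * dist x y powr (2 - \<alpha>))
             * indicator (\<Omega> \<inter> {x. norm (grad u x) > 0}) x \<partial>lborel)"
  define e where "e k = 1 / real (Suc k)" for k
  have e: "\<And>k. 0 < e k" "decseq e" "e \<longlonglongrightarrow> 0"
  proof -
    show "0 < e k" for k by (simp add: e_def)
    show "decseq e" by (rule decseq_SucI) (simp add: e_def field_simps)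
    show "e \<longlonglongrightarrow> 0" unfolding e_def by (rule LIMSEQ_Suc[OF lim_1_over_n])
  qed
  define Ak where "Ak k = (\<integral>\<^sup>+ x. ennreal (mass \<phi> y \<alpha> (e k) x) \<partial>lborel)" for k
  define Dk where "Dk k = (\<integral>\<^sup>+ x. ennreal (radial_mass \<phi> y \<alpha> (e k) x) \<partial>lborel)" for k
  note lims = nn_integral_mass_LIMSEQ[OF \<Omega>V \<phi> assms(5) e, of y]
  have limA: "Ak \<longlonglongrightarrow> A" and limD: "Dk \<longlonglongrightarrow> D" and incA: "incseq Ak"
    using lims unfolding Ak_def[abs_def] Dk_def[abs_def] A_def D_def by auto
  have AkA: "Ak k \<le> A" for k using incseq_le[OF incA limA] .
  have Ak_fin: "Ak k \<noteq> \<infinity>" for k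
    unfolding Ak_def by (rule nn_integral_mass_finite[OF V(2) \<phi> e(1)])
  have est: "ennreal ?c * Ak k + ennreal \<alpha> * Dk k \<le> ennsqrt (Ak k) * ennsqrt B" for k
  proof -
    have "(ennreal ?c * Ak k + ennreal \<alpha> * Dk k)\<^sup>2 \<le> Ak k * (\<integral>\<^sup>+ x. ennreal (energy \<phi> y \<alpha> (e k) x) \<partial>lborel)"
      unfolding Ak_def Dk_def
      by (rule weighted_estimate[OF V \<phi> e(1) assms(5,6) AE_grad_eq_0_on_zero_set[OF \<rho>] assms(7)])
    also have "\<dots> \<le> Ak k * B"
      unfolding B_def
      by (intro mult_left_mono nn_integral_mono order_trans[OF energy_le[OF e(1) assms(5)]])
        (simp_all add: tan_energy_def)
    finally show ?thesis using Ak_fin by (rule le_ennsqrt_mult)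
  qed
  have lim_c: "(\<lambda>k. ennreal m * Ak k) \<longlonglongrightarrow> ennreal m * A" for m
    by (intro ennreal_tendsto_cmult limA) simp
  have P1: "ennreal ?c * A + ennreal \<alpha> * D \<le> ennsqrt A * ennsqrt B"
  proof (rule LIMSEQ_le_const2)
    show "(\<lambda>k. ennreal ?c * Ak k + ennreal \<alpha> * Dk k) \<longlonglongrightarrow> ennreal ?c * A + ennreal \<alpha> * D"
      by (intro tendsto_add lim_c ennreal_tendsto_cmult limD) simp
    have "ennreal ?c * Ak k + ennreal \<alpha> * Dk k \<le> ennsqrt A * ennsqrt B" for k
      using est[of k] by (rule order_trans) (intro mult_right_mono ennsqrt_mono AkA, simp)
    then show "\<exists>N. \<forall>k\<ge>N. ennreal ?c * Ak k + ennreal \<alpha> * Dk k \<le> ennsqrt A * ennsqrt B" by blast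
  qed
  have P2: "ennreal (?c\<^sup>2) * A \<le> B"
  proof (rule LIMSEQ_le_const2[OF lim_c])
    \<comment> \<open>The square root is cancelled while \<open>Ak k\<close> is known to be finite;
      only then is the limit taken.\<close>
    have "ennreal (?c\<^sup>2) * Ak k \<le> B" for k
    proof (rule mult_le_of_le_ennsqrt)
      show "ennreal ?c * Ak k \<le> ennsqrt (Ak k) * ennsqrt B"
        using est[of k] by (rule order_trans[rotated]) simp
    qed (use Ak_fin assms(6) in auto)
    then show "\<exists>N. \<forall>k\<ge>N. ennreal (?c\<^sup>2) * Ak k \<le> B" by blast
  qed
  have P3: "ennreal ((real DIM('a) - 1)\<^sup>2) *
        (\<integral>\<^sup>+ x. ennreal (\<bar>rad_deriv u y x\<bar> * (\<phi> x)\<^sup>2 * dist x y powr (-\<alpha>)) * indicator \<Omega> x \<partial>lborel)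
    \<le> (\<integral>\<^sup>+ x. ennreal (\<bar>rad_deriv u y x\<bar> *
               (4 * (norm (tan_grad u \<phi> x))\<^sup>2 + (mean_curv u x)\<^sup>2 * (\<phi> x)\<^sup>2) * dist x y powr (2 - \<alpha>))
             * indicator (\<Omega> \<inter> {x. norm (grad u x) > 0}) x \<partial>lborel)"
    if rad: "\<exists>g. \<forall>x\<in>closure \<Omega>. u x = g (dist x y)"
  proof -
    obtain g where g: "\<And>x. x \<in> \<Omega> \<Longrightarrow> u x = g (dist x y)"
      using rad closure_subset by blast
    have N: "norm (grad u x) = \<bar>rad_deriv u y x\<bar>" if "x \<in> \<Omega>" "x \<noteq> y" for x
      by (rule norm_grad_radial[OF open_\<Omega> that g has_derivative_u[OF that(1)]])
    have "(\<integral>\<^sup>+ x. ennreal (\<bar>rad_deriv u y x\<bar> * (\<phi> x)\<^sup>2 * dist x y powr (-\<alpha>)) * indicator \<Omega> x \<partial>lborel) = A"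
      unfolding A_def
    proof (rule nn_integral_cong)
      fix x show "ennreal (\<bar>rad_deriv u y x\<bar> * (\<phi> x)\<^sup>2 * dist x y powr (-\<alpha>)) * indicator \<Omega> x
        = ennreal (norm (grad u x) * (\<phi> x)\<^sup>2 * dist x y powr (-\<alpha>)) * indicator \<Omega> x"
        \<comment> \<open>N says nothing at y, where the factor
          \<open>dist x y powr (-\<alpha>)\<close> is 0.\<close>
        using N[of x] by (cases "x \<in> \<Omega>"; cases "x = y") auto
    qed
    moreover have "(\<integral>\<^sup>+ x. ennreal (\<bar>rad_deriv u y x\<bar> *
               (4 * (norm (tan_grad u \<phi> x))\<^sup>2 + (mean_curv u x)\<^sup>2 * (\<phi> x)\<^sup>2) * dist x y powr (2 - \<alpha>))
             * indicator (\<Omega> \<inter> {x. norm (grad u x) > 0}) x \<partial>lborel) = B"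
      unfolding B_def
    proof (rule nn_integral_cong)
      fix x show "ennreal (\<bar>rad_deriv u y x\<bar> *
               (4 * (norm (tan_grad u \<phi> x))\<^sup>2 + (mean_curv u x)\<^sup>2 * (\<phi> x)\<^sup>2) * dist x y powr (2 - \<alpha>))
             * indicator (\<Omega> \<inter> {x. norm (grad u x) > 0}) x
        = ennreal (norm (grad u x) *
               (4 * (norm (tan_grad u \<phi> x))\<^sup>2 + (mean_curv u x)\<^sup>2 * (\<phi> x)\<^sup>2) * dist x y powr (2 - \<alpha>))
             * indicator (\<Omega> \<inter> {x. norm (grad u x) > 0}) x"
        using N[of x] by (cases "x \<in> \<Omega>"; cases "x = y") auto
    qed
    moreover have "D = A"
      unfolding A_def D_def
    proof (rule nn_integral_cong)
      fix x show "ennreal ((rad_deriv u y x)\<^sup>2 / norm (grad u x) * (\<phi> x)\<^sup>2 * dist x y powr (-\<alpha>)) * indicator \<Omega> x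
        = ennreal (norm (grad u x) * (\<phi> x)\<^sup>2 * dist x y powr (-\<alpha>)) * indicator \<Omega> x"
      proof (cases "x \<in> \<Omega> \<and> x \<noteq> y")
        case True
        then have "(rad_deriv u y x)\<^sup>2 = (norm (grad u x))\<^sup>2" using N by simp
        then show ?thesis by (simp add: power2_eq_square)
      qed auto
    qed
    ultimately show ?thesis
    proof (simp only:)
      \<comment> \<open>The constant in P2 is positive, so an infinite A forces B to be infinite,
        and then the claim is trivial.\<close>
      have "A \<noteq> \<infinity> \<or> B = \<infinity>"
        using P2 assms(6) by (auto simp: ennreal_mult_top top_unique)
      moreover have "ennreal (real DIM('a) - 1) * A \<le> ennsqrt A * ennsqrt B"
      proof -
        have "ennreal (real DIM('a) - 1) = ennreal ?c + ennreal \<alpha>"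
          using assms(5,6) by (simp add: ennreal_plus[symmetric])
        then show ?thesis using P1 \<open>D = A\<close> by (simp add: distrib_right)
      qed
      ultimately show "ennreal ((real DIM('a) - 1)\<^sup>2) * A \<le> B"
        using mult_le_of_le_ennsqrt[of "real DIM('a) - 1" A B] assms(5,6) by auto
    qed
  qed
  show ?thesis
    unfolding A_def[symmetric] D_def[symmetric] B_def[symmetric]
    using P1 P2 P3 by blast
qed

end
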